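(* For every $k\in(0,\frac{\sqrt2}{2}]$ there does not exist a two-end solution with growth rate $k$.
   Context: Let $H(x)=\tanh\frac{x}{\sqrt2}$. A two-end solution with growth rate $k$ is a classical solution $u=u(r,z)$, $|u|<1$, of $$u_{zz}+u_{rr}+r^{-1}u_{r}+u-u^{3}=0,\quad r\in[0,+\infty),\ z\in\mathbb{R},\qquad u(r,z)=u(r,-z),\quad u_{r}(0,z)=0$$ (i.e. an axially symmetric solution, even in $z$, of the Allen-Cahn equation $-\Delta u=u-u^3$ in $\mathbb{R}^3$, with $r=\sqrt{x^2+y^2}$), such that for some $c\in\mathbb{R}$ $$\|u(r,\cdot)-H(\cdot-k\ln r+c)\|_{L^\infty(0,+\infty)}\to0\quad\text{as } r\to+\infty,$$ the norm being taken in $z\in(0,+\infty)$. *)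

theory Defs
  imports "HOL-Probability.Essential_Supremum"
begin

definition H :: "real \<Rightarrow> real" where
  "H x = tanh (x / sqrt 2)"

text \<open>
  Functions on the closed half-plane \<open>r \<ge> 0\<close>, \<open>z \<in> \<real>\<close> are represented by total curried functions;
  their values for \<open>r < 0\<close> are irrelevant everywhere below. In particular the derivative in \<open>r\<close> is
  taken within \<open>{0..}\<close>, so it is one-sided at \<open>r = 0\<close>.
\<close>

definition d_r :: "(real \<Rightarrow> real \<Rightarrow> real) \<Rightarrow> real \<Rightarrow> real \<Rightarrow> real" where
  "d_r f r z = vector_derivative (\<lambda>s. f s z) (at r within {0..})"

definition d_z :: "(real \<Rightarrow> real \<Rightarrow> real) \<Rightarrow> real \<Rightarrow> real \<Rightarrow> real" where
  "d_z f r z = deriv (f r) z"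

definition C1_half_plane :: "(real \<Rightarrow> real \<Rightarrow> real) \<Rightarrow> bool" where
  "C1_half_plane f \<longleftrightarrow>
     (\<forall>r\<ge>0. \<forall>z. (\<lambda>s. f s z) differentiable (at r within {0..}) \<and> f r differentiable (at z)) \<and>
     continuous_on ({0..} \<times> UNIV) (\<lambda>(r, z). d_r f r z) \<and>
     continuous_on ({0..} \<times> UNIV) (\<lambda>(r, z). d_z f r z)"

definition C2_half_plane :: "(real \<Rightarrow> real \<Rightarrow> real) \<Rightarrow> bool" where
  "C2_half_plane f \<longleftrightarrow> C1_half_plane f \<and> C1_half_plane (d_r f) \<and> C1_half_plane (d_z f)"

text \<open>
  The equation is imposed for \<open>r > 0\<close> only: at \<open>r = 0\<close> the term \<open>u\<^sub>r / r\<close> has to be read as its limit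
  \<open>u\<^sub>r\<^sub>r\<close>, whereas division by zero would make it vanish. The equation on the axis follows by
  continuity. Together with \<open>u\<^sub>r = 0\<close> on the axis, being \<open>C\<^sup>2\<close> up to \<open>r = 0\<close> amounts to
  \<open>(x, y, z) \<mapsto> u (sqrt (x\<^sup>2 + y\<^sup>2)) z\<close> being a \<open>C\<^sup>2\<close> solution of \<open>- \<Delta>u = u - u\<^sup>3\<close> on \<open>\<real>\<^sup>3\<close>.
\<close>

definition axial_Allen_Cahn_solution :: "(real \<Rightarrow> real \<Rightarrow> real) \<Rightarrow> bool" where
  "axial_Allen_Cahn_solution u \<longleftrightarrow>
     C2_half_plane u \<and>
     (\<forall>r>0. \<forall>z. d_z (d_z u) r z + d_r (d_r u) r z + d_r u r z / r + u r z - (u r z) ^ 3 = 0) \<and>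
     (\<forall>r\<ge>0. \<forall>z. u r z = u r (- z)) \<and>
     (\<forall>z. d_r u 0 z = 0)"

definition two_end_solution :: "real \<Rightarrow> (real \<Rightarrow> real \<Rightarrow> real) \<Rightarrow> bool" where
  "two_end_solution k u \<longleftrightarrow>
     axial_Allen_Cahn_solution u \<and>
     (\<forall>r\<ge>0. \<forall>z. \<bar>u r z\<bar> < 1) \<and>
     (\<exists>c::real.
        ((\<lambda>r. esssup (lebesgue_on {0<..}) (\<lambda>z. ereal \<bar>u r z - H (z - k * ln r + c)\<bar>)) \<longlongrightarrow> 0) at_top)"

end

theory Submission
  imports Defs
begin

text \<open>
  For \<open>z > 0\<close> the interface sits at height \<open>q r = k * ln r - c\<close>. Multiplying the equation by \<open>u\<^sub>z\<close> and
  integrating over \<open>z > 0\<close> gives a balance law for the flux \<open>F r = - r * \<integral> u\<^sub>r * u\<^sub>z dz\<close>, namely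
  \<open>F' = r * (u\<^sub>r\<^sup>2 / 2 + W (u r 0))\<close> with \<open>W x = (1 - x\<^sup>2)\<^sup>2 / 4\<close>; multiplying by \<open>u\<^sub>r\<close> gives
  \<open>E' = D / r\<close> for \<open>E = \<integral> u\<^sub>z\<^sup>2 / 2 + W u - u\<^sub>r\<^sup>2 / 2 dz\<close> and \<open>D = \<integral> u\<^sub>r\<^sup>2 dz\<close>. A barrier shows that \<open>1 + u r 0\<close>
  is at least a multiple of \<open>r powr - (sqrt 2 * k)\<close>, hence of \<open>1 / r\<close> when \<open>k \<le> sqrt 2 / 2\<close>, so that
  \<open>F\<close> grows at least like \<open>ln r\<close>: the two sheets repel each other too much.

  On the other hand \<open>E\<close> increases to at most the energy \<open>\<sigma>\<close> of the one-dimensional profile, and completing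
  the square in \<open>E\<close> bounds the defect \<open>T = \<sigma> - E\<close> by \<open>D / 2 + 4 * W (u r 0)\<close>. With \<open>T' = - D / r\<close> this makes
  \<open>r\<^sup>2 * T - 8 * F\<close> essentially nonincreasing, whence \<open>r\<^sup>2 * T \<le> 8 * F + const\<close>. The Cauchy-Schwarz
  inequality \<open>F\<^sup>2 \<le> const * r\<^sup>2 * D\<close>, integrated over \<open>[r, 2 * r]\<close>, gives \<open>F\<^sup>2 \<le> const * r\<^sup>2 * T\<close>. Hence \<open>F\<close> is
  bounded, a contradiction. No asymptotics of \<open>r * u\<^sub>r\<close> are needed.
\<close>

section \<open>Maximum principles and gradient estimates\<close>

text \<open>If \<open>D\<close> were positive, \<open>f'\<close> would be positive immediately to
  the right of its zero \<open>a\<close>, and the mean value theorem would make \<open>f\<close>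
  exceed \<open>f a\<close> there. The second derivative enters only through its value at
  \<open>a\<close>.\<close>

lemma second_derivative_test_max:
  fixes f f' :: "real \<Rightarrow> real"
  assumes e: "e > 0"
    and f: "\<And>x. \<bar>x - a\<bar> < e \<Longrightarrow> (f has_real_derivative f' x) (at x)"
    and f': "(f' has_real_derivative D) (at a)"
    and max: "\<And>x. \<bar>x - a\<bar> < e \<Longrightarrow> f x \<le> f a"
  shows "f' a = 0" "D \<le> 0"
proof -
  show z: "f' a = 0"
    by (rule DERIV_local_max[OF f e]) (use max e in \<open>auto simp: abs_minus_commute\<close>)
  show "D \<le> 0"
  proof (rule ccontr)
    assume "\<not> D \<le> 0"
    then obtain d where d: "d > 0" "\<And>h. 0 < h \<Longrightarrow> h < d \<Longrightarrow> f' a < f' (a + h)"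
      using DERIV_pos_inc_right[OF f'] by auto
    define h where "h = min d e / 2"
    have h: "0 < h" "h < d" "h < e" using d e by (auto simp: h_def)
    obtain y where y: "a < y" "y < a + h" "f (a + h) - f a = (a + h - a) * f' y"
      using MVT2[of a "a + h" f f'] h f by (auto simp: abs_real_def split: if_splits)
    have "f' (a + (y - a)) > f' a" by (rule d(2)) (use y h in auto)
    then have "h * f' y > 0" using z h by simp
    then have "f (a + h) > f a" using y(3) by simp
    moreover have "f (a + h) \<le> f a" using max h by auto
    ultimately show False by simp
  qed
qed

text \<open>A positive maximum over the compact rectangle is interior by \<open>bdry\<close>, and
  the second derivative test in each variable then contradicts \<open>no_max\<close>. Keeping the
  differential operator inside \<open>no_max\<close> lets each barrier argument verify that
  condition for its own equation.\<close>

lemma maximum_principle_rectangle: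
  fixes g gx gy gxx gyy :: "real \<Rightarrow> real \<Rightarrow> real"
  assumes cont: "continuous_on ({a..b} \<times> {c..d}) (\<lambda>(x, y). g x y)"
    and gx: "\<And>x y. a < x \<Longrightarrow> x < b \<Longrightarrow> c < y \<Longrightarrow> y < d \<Longrightarrow> ((\<lambda>x. g x y) has_real_derivative gx x y) (at x)"
    and gxx: "\<And>x y. a < x \<Longrightarrow> x < b \<Longrightarrow> c < y \<Longrightarrow> y < d \<Longrightarrow> ((\<lambda>x. gx x y) has_real_derivative gxx x y) (at x)"
    and gy: "\<And>x y. a < x \<Longrightarrow> x < b \<Longrightarrow> c < y \<Longrightarrow> y < d \<Longrightarrow> (g x has_real_derivative gy x y) (at y)"
    and gyy: "\<And>x y. a < x \<Longrightarrow> x < b \<Longrightarrow> c < y \<Longrightarrow> y < d \<Longrightarrow> (gy x has_real_derivative gyy x y) (at y)"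
    and bdry: "\<And>x y. a \<le> x \<Longrightarrow> x \<le> b \<Longrightarrow> c \<le> y \<Longrightarrow> y \<le> d \<Longrightarrow> x = a \<or> x = b \<or> y = c \<or> y = d \<Longrightarrow> g x y \<le> 0"
    and no_max: "\<And>x y. a < x \<Longrightarrow> x < b \<Longrightarrow> c < y \<Longrightarrow> y < d \<Longrightarrow> g x y > 0 \<Longrightarrow> gx x y = 0 \<Longrightarrow> gy x y = 0 \<Longrightarrow>
      gxx x y \<le> 0 \<Longrightarrow> gyy x y \<le> 0 \<Longrightarrow> False"
    and xy: "a \<le> x" "x \<le> b" "c \<le> y" "y \<le> d"
  shows "g x y \<le> 0"
proof (rule ccontr)
  assume "\<not> g x y \<le> 0"
  have "compact ({a..b} \<times> {c..d})" by (intro compact_Times) auto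
  moreover have "{a..b} \<times> {c..d} \<noteq> {}" using xy by auto
  ultimately obtain p where p: "p \<in> {a..b} \<times> {c..d}"
      and pmax: "\<And>q. q \<in> {a..b} \<times> {c..d} \<Longrightarrow> (\<lambda>(x, y). g x y) q \<le> (\<lambda>(x, y). g x y) p"
    using continuous_attains_sup[OF _ _ cont] by blast
  obtain s t where st: "p = (s, t)" by force
  have pos: "g s t > 0" using pmax[of "(x, y)"] xy \<open>\<not> g x y \<le> 0\<close> st by auto
  then have int: "a < s" "s < b" "c < t" "t < d"
    using bdry[of s t] p st by force+
  define e where "e = min (min (s - a) (b - s)) (min (t - c) (d - t))"
  have e: "e > 0" using int by (auto simp: e_def)
  have 1: "gx s t = 0" "gxx s t \<le> 0"
  proof -
    have A: "\<bar>x - s\<bar> < e \<Longrightarrow> ((\<lambda>x. g x t) has_real_derivative gx x t) (at x)" for x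
      by (rule gx) (use int in \<open>auto simp: e_def\<close>)
    have B: "\<bar>x - s\<bar> < e \<Longrightarrow> g x t \<le> g s t" for x
      using pmax[of "(x, t)"] int st by (auto simp: e_def abs_real_def split: if_splits)
    show "gx s t = 0" "gxx s t \<le> 0"
      using second_derivative_test_max[of e s "\<lambda>x. g x t" "\<lambda>x. gx x t" "gxx s t"] A B gxx[OF int] e by auto
  qed
  have 2: "gy s t = 0" "gyy s t \<le> 0"
  proof -
    have A: "\<bar>y - t\<bar> < e \<Longrightarrow> (g s has_real_derivative gy s y) (at y)" for y
      by (rule gy) (use int in \<open>auto simp: e_def\<close>)
    have B: "\<bar>y - t\<bar> < e \<Longrightarrow> g s y \<le> g s t" for y
      using pmax[of "(s, y)"] int st by (auto simp: e_def abs_real_def split: if_splits)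
    show "gy s t = 0" "gyy s t \<le> 0"
      using second_derivative_test_max[of e t "g s" "gy s" "gyy s t"] A B gyy[OF int] e by auto
  qed
  show False by (rule no_max[OF int pos 1(1) 2(1) 1(2) 2(2)])
qed

text \<open>
  The equation for \<open>f\<close> makes \<open>f x y - f x' y\<close> nearly a solution in the three variables \<open>x' \<le> x\<close> and \<open>y\<close>
  that vanishes on \<open>x = x'\<close>, so comparison with a barrier vanishing there bounds \<open>f\<^sub>x\<close> without
  any bound on higher derivatives.
\<close>

lemma doubling_gradient_bound:
  fixes f fx fy fxx fyy :: "real \<Rightarrow> real \<Rightarrow> real" and b e :: "real \<Rightarrow> real"
  assumes cont: "continuous_on ({x0-1..x0+1} \<times> {y0-1..y0+1}) (\<lambda>(x, y). f x y)"
    and fx: "\<And>x y. \<bar>x - x0\<bar> \<le> 1 \<Longrightarrow> \<bar>y - y0\<bar> \<le> 1 \<Longrightarrow> ((\<lambda>x. f x y) has_real_derivative fx x y) (at x)"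
    and fxx: "\<And>x y. \<bar>x - x0\<bar> \<le> 1 \<Longrightarrow> \<bar>y - y0\<bar> \<le> 1 \<Longrightarrow> ((\<lambda>x. fx x y) has_real_derivative fxx x y) (at x)"
    and fy: "\<And>x y. \<bar>x - x0\<bar> \<le> 1 \<Longrightarrow> \<bar>y - y0\<bar> \<le> 1 \<Longrightarrow> (f x has_real_derivative fy x y) (at y)"
    and fyy: "\<And>x y. \<bar>x - x0\<bar> \<le> 1 \<Longrightarrow> \<bar>y - y0\<bar> \<le> 1 \<Longrightarrow> (fy x has_real_derivative fyy x y) (at y)"
    and M: "\<And>x y. \<bar>x - x0\<bar> \<le> 1 \<Longrightarrow> \<bar>y - y0\<bar> \<le> 1 \<Longrightarrow> \<bar>f x y\<bar> \<le> M" and M0: "M > 0"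
    and N: "\<And>x y. \<bar>x - x0\<bar> \<le> 1 \<Longrightarrow> \<bar>y - y0\<bar> \<le> 1 \<Longrightarrow>
      \<bar>fxx x y + b x * fx x y + fyy x y + e y * fy x y\<bar> \<le> N"
    and b: "\<And>x. \<bar>x - x0\<bar> \<le> 1 \<Longrightarrow> \<bar>b x\<bar> \<le> 1" and e: "\<And>y. \<bar>y - y0\<bar> \<le> 1 \<Longrightarrow> \<bar>e y\<bar> \<le> 1"
  shows "fx x0 y0 \<le> 7 * (N + 13 * M)"
proof -
  \<comment> \<open>Chosen so that the final upper estimate \<open>- 2 * K + 24 * M\<close> lies
    strictly below \<open>- 2 * N\<close>; with \<open>12 * M\<close> there would be
    equality.\<close>
  define K where "K = N + 13 * M"
  have N0: "N \<ge> 0" using N[of x0 y0] by auto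
  have K0: "K > 0" using N0 M0 by (simp add: K_def)
  \<comment> \<open>This function vanishes at 0, is nondecreasing on [0, 2] and satisfies \<eta>'' +
    \<eta>' = -1, which absorbs drift coefficients of size at most 1. The largest possible value of
    \<open>x - x'\<close> is 2.\<close>
  define \<eta> where "\<eta> t = exp 2 * (1 - exp (- t)) - t" for t :: real
  define \<eta>' where "\<eta>' t = exp (2 - t) - 1" for t :: real
  have \<eta>_deriv: "(\<eta> has_real_derivative \<eta>' t) (at t)" for t
    unfolding \<eta>_def \<eta>'_def by (auto intro!: derivative_eq_intros simp: exp_diff exp_minus field_simps)
  have \<eta>'_deriv: "(\<eta>' has_real_derivative - exp (2 - t)) (at t)" for t
    unfolding \<eta>'_def by (auto intro!: derivative_eq_intros)
  have \<eta>_chain: "((\<lambda>x. \<eta> (g x)) has_real_derivative D) (at x)"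
    if "(g has_real_derivative d) (at x)" "\<eta>' (g x) * d = D" for g d D x
    using DERIV_chain2[OF \<eta>_deriv that(1)] that(2) by simp
  have \<eta>'_chain: "((\<lambda>x. \<eta>' (g x)) has_real_derivative D) (at x)"
    if "(g has_real_derivative d) (at x)" "- exp (2 - g x) * d = D" for g d D x
    using DERIV_chain2[OF \<eta>'_deriv that(1)] that(2) by simp
  note eq_intros = derivative_eq_intros \<eta>_chain \<eta>'_chain
    fx[THEN DERIV_cong] fxx[THEN DERIV_cong] fy[THEN DERIV_cong] fyy[THEN DERIV_cong]
  have \<eta>_nonneg: "\<eta> t \<ge> 0" if "0 \<le> t" "t \<le> 2" for t
  proof -
    have "\<eta> 0 \<le> \<eta> t"
      by (rule DERIV_nonneg_imp_nondecreasing[OF that(1)])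
        (use that \<eta>_deriv in \<open>auto simp: \<eta>'_def intro!: exI\<close>)
    then show ?thesis by (simp add: \<eta>_def)
  qed
  \<comment> \<open>The \<open>K\<close> term is the barrier vanishing on \<open>x = x'\<close>. The
    quadratic term is at least \<open>2 * M\<close> outside the open unit ball around
    \<open>(x0, x0, y0)\<close>, where it dominates \<open>f x y - f x' y\<close>; this keeps a
    positive maximum of \<open>G\<close> away from the outer boundary.\<close>
  define \<psi> where "\<psi> x x' y = K * \<eta> (x - x') + 2 * M * ((y - y0)^2 + (x - x0)^2 + (x' - x0)^2)" for x x' y
  define G where "G x x' y = f x y - f x' y - \<psi> x x' y" for x x' y
  define S where "S = {(x, x', y). x' \<le> x \<and> \<bar>x - x0\<bar> \<le> 1 \<and> \<bar>x' - x0\<bar> \<le> 1 \<and> \<bar>y - y0\<bar> \<le> 1}"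
  have S_alt: "S = ({x0-1..x0+1} \<times> {x0-1..x0+1} \<times> {y0-1..y0+1}) \<inter> {p. fst (snd p) \<le> fst p}"
    by (auto simp: S_def abs_real_def split: if_splits)
  have "compact S" unfolding S_alt
    by (intro compact_Int_closed compact_Times closed_Collect_le continuous_intros) auto
  moreover have "S \<noteq> {}" proof -
    have "(x0, x0, y0) \<in> S" by (simp add: S_def)
    then show ?thesis by blast
  qed
  moreover have "continuous_on S (\<lambda>(x, x', y). G x x' y)"
  proof -
    have "continuous_on S (\<lambda>p. (\<lambda>(x, y). f x y) (fst p, snd (snd p)))"
      by (rule continuous_on_compose2[OF cont]) (auto intro!: continuous_intros simp: S_alt)
    moreover have "continuous_on S (\<lambda>p. (\<lambda>(x, y). f x y) (fst (snd p), snd (snd p)))"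
      by (rule continuous_on_compose2[OF cont]) (auto intro!: continuous_intros simp: S_alt)
    ultimately show ?thesis unfolding G_def \<psi>_def \<eta>_def split_beta
      by (auto intro!: continuous_intros)
  qed
  ultimately obtain p where "p \<in> S"
      and pmax: "\<And>q. q \<in> S \<Longrightarrow> (\<lambda>(x, x', y). G x x' y) q \<le> (\<lambda>(x, x', y). G x x' y) p"
    using continuous_attains_sup[of S "\<lambda>(x, x', y). G x x' y"] by blast
  then obtain s s' t where p: "p = (s, s', t)" and S: "s' \<le> s" "\<bar>s - x0\<bar> \<le> 1" "\<bar>s' - x0\<bar> \<le> 1" "\<bar>t - y0\<bar> \<le> 1"
    by (auto simp: S_def)
  have Gmax: "G x x' y \<le> G s s' t" if "x' \<le> x" "\<bar>x - x0\<bar> \<le> 1" "\<bar>x' - x0\<bar> \<le> 1" "\<bar>y - y0\<bar> \<le> 1" for x x' y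
    using pmax[of "(x, x', y)"] that p by (auto simp: S_def)
  have main: "G s s' t \<le> 0"
  proof (rule ccontr)
    assume neg: "\<not> G s s' t \<le> 0"
    have \<eta>s: "\<eta> (s - s') \<ge> 0" using S by (intro \<eta>_nonneg) (auto simp: abs_real_def split: if_splits)
    have fd: "f s t - f s' t \<le> 2 * M" using M[of s t] M[of s' t] S by auto
    have sq: "(t - y0)^2 + (s - x0)^2 + (s' - x0)^2 < 1"
    proof (rule ccontr)
      assume "\<not> ?thesis"
      then have "2 * M * ((t - y0)^2 + (s - x0)^2 + (s' - x0)^2) \<ge> 2 * M * 1"
        using M0 by (intro mult_left_mono) auto
      moreover have "K * \<eta> (s - s') \<ge> 0" using K0 \<eta>s by simp
      ultimately show False using neg fd by (auto simp: G_def \<psi>_def)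
    qed
    have lt: "\<bar>t - y0\<bar> < 1" "\<bar>s - x0\<bar> < 1" "\<bar>s' - x0\<bar> < 1"
      using sq zero_le_power2[of "t - y0"] zero_le_power2[of "s - x0"] zero_le_power2[of "s' - x0"]
      unfolding abs_square_less_1[symmetric] by linarith+
    have "s' \<noteq> s"
    proof
      assume "s' = s"
      then have "G s s' t = - (2 * M * ((t - y0)^2 + (s - x0)^2 + (s' - x0)^2))" by (simp add: G_def \<psi>_def \<eta>_def)
      also have "\<dots> \<le> 0" using M0 by simp
      finally show False using neg by simp
    qed
    then have lts: "s' < s" using S by simp
    \<comment> \<open>Radius within which each of the three coordinates can be moved alone without
      leaving \<open>S\<close>.\<close>
    define r where "r = min (min (1 - \<bar>t - y0\<bar>) (s - s')) (min (1 - \<bar>s - x0\<bar>) (1 - \<bar>s' - x0\<bar>))"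
    have r: "r > 0" using lt lts by (simp add: r_def)
    have near: "\<bar>x - x0\<bar> \<le> 1" "s' \<le> x" if "\<bar>x - s\<bar> < r" for x
    proof -
      have "\<bar>x - s\<bar> < 1 - \<bar>s - x0\<bar>" "\<bar>x - s\<bar> < s - s'"
        using that by (simp_all add: r_def)
      then show "\<bar>x - x0\<bar> \<le> 1" "s' \<le> x" by linarith+
    qed
    have near': "\<bar>x - x0\<bar> \<le> 1" "x \<le> s" if "\<bar>x - s'\<bar> < r" for x
    proof -
      have "\<bar>x - s'\<bar> < 1 - \<bar>s' - x0\<bar>" "\<bar>x - s'\<bar> < s - s'"
        using that by (simp_all add: r_def)
      then show "\<bar>x - x0\<bar> \<le> 1" "x \<le> s" by linarith+
    qed
    have neary: "\<bar>y - y0\<bar> \<le> 1" if "\<bar>y - t\<bar> < r" for y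
    proof -
      have "\<bar>y - t\<bar> < 1 - \<bar>t - y0\<bar>" "\<bar>y - t\<bar> < s - s'"
        using that by (simp_all add: r_def)
      then show "\<bar>y - y0\<bar> \<le> 1" by linarith+
    qed
    have 1: "fx s t - (K * \<eta>' (s - s') + 4 * M * (s - x0)) = 0"
         "fxx s t - (K * (- exp (2 - (s - s'))) + 4 * M) \<le> 0"
    proof -
      define g where "g x = fx x t - (K * \<eta>' (x - s') + 4 * M * (x - x0))" for x
      have A: "((\<lambda>x. G x s' t) has_real_derivative g x) (at x)" if "\<bar>x - s\<bar> < r" for x
        unfolding G_def \<psi>_def g_def
        using that lt near[OF that] by (auto intro!: eq_intros)
      have B: "(g has_real_derivative fxx s t - (K * (- exp (2 - (s - s'))) + 4 * M)) (at s)"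
        unfolding g_def
        using lt by (auto intro!: eq_intros)
      have C: "G x s' t \<le> G s s' t" if "\<bar>x - s\<bar> < r" for x
        by (rule Gmax) (use that lt near[OF that] in auto)
      show "fx s t - (K * \<eta>' (s - s') + 4 * M * (s - x0)) = 0"
         "fxx s t - (K * (- exp (2 - (s - s'))) + 4 * M) \<le> 0"
        using second_derivative_test_max[OF r A B C] by (auto simp: g_def)
    qed
    have 2: "- fx s' t + K * \<eta>' (s - s') - 4 * M * (s' - x0) = 0"
         "- fxx s' t + K * exp (2 - (s - s')) - 4 * M \<le> 0"
    proof -
      define g where "g x = - fx x t + K * \<eta>' (s - x) - 4 * M * (x - x0)" for x
      have A: "((\<lambda>x. G s x t) has_real_derivative g x) (at x)" if "\<bar>x - s'\<bar> < r" for x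
        unfolding G_def \<psi>_def g_def
        using that lt near'[OF that] by (auto intro!: eq_intros)
      have B: "(g has_real_derivative - fxx s' t + K * exp (2 - (s - s')) - 4 * M) (at s')"
        unfolding g_def
        using lt by (auto intro!: eq_intros)
      have C: "G s x t \<le> G s s' t" if "\<bar>x - s'\<bar> < r" for x
        by (rule Gmax) (use that lt near'[OF that] in auto)
      show "- fx s' t + K * \<eta>' (s - s') - 4 * M * (s' - x0) = 0"
         "- fxx s' t + K * exp (2 - (s - s')) - 4 * M \<le> 0"
        using second_derivative_test_max[OF r A B C] by (auto simp: g_def)
    qed
    have 3: "fy s t - fy s' t - 4 * M * (t - y0) = 0" "fyy s t - fyy s' t - 4 * M \<le> 0"
    proof -
      define g where "g y = fy s y - fy s' y - 4 * M * (y - y0)" for y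
      have A: "(G s s' has_real_derivative g y) (at y)" if "\<bar>y - t\<bar> < r" for y
        unfolding G_def \<psi>_def g_def
        using that lt neary[OF that] by (auto intro!: eq_intros)
      have B: "(g has_real_derivative fyy s t - fyy s' t - 4 * M) (at t)"
        unfolding g_def
        using lt by (auto intro!: eq_intros)
      have C: "G s s' y \<le> G s s' t" if "\<bar>y - t\<bar> < r" for y
        by (rule Gmax) (use that lt neary[OF that] S in auto)
      show "fy s t - fy s' t - 4 * M * (t - y0) = 0" "fyy s t - fyy s' t - 4 * M \<le> 0"
        using second_derivative_test_max[OF r A B C] by (auto simp: g_def)
    qed
    have eqs: "fx s t = K * \<eta>' (s - s') + 4 * M * (s - x0)" "fx s' t = K * \<eta>' (s - s') - 4 * M * (s' - x0)"
      "fy s t - fy s' t = 4 * M * (t - y0)" using 1 2 3 by auto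
    have \<eta>'s: "\<eta>' (s - s') \<ge> 0" using S by (auto simp: \<eta>'_def)
    have bb: "b s - b s' \<le> 2" using b[of s] b[of s'] S by auto
    have prod: "\<beta> * x \<le> 1" if "\<bar>\<beta>\<bar> \<le> 1" "\<bar>x\<bar> \<le> 1" for \<beta> x :: real
      using mult_mono[OF that] by (simp flip: abs_mult)
    \<comment> \<open>The equations at \<open>(s, t)\<close> and \<open>(s', t)\<close> are
      subtracted. The first-order conditions \<open>eqs\<close> turn the remaining first derivatives
      into explicit barrier terms; the common \<open>t\<close> means that only the difference of the
      \<open>fy\<close> is needed.\<close>
    have "- 2 * N \<le> (fxx s t + b s * fx s t + fyy s t + e t * fy s t)
          - (fxx s' t + b s' * fx s' t + fyy s' t + e t * fy s' t)"
      using N[of s t] N[of s' t] S by auto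
    also have "\<dots> = (fxx s t - fxx s' t) + (fyy s t - fyy s' t) + e t * (fy s t - fy s' t) + b s * fx s t - b s' * fx s' t"
      by (simp add: algebra_simps)
    also have "\<dots> = (fxx s t - fxx s' t) + (fyy s t - fyy s' t) + 4 * M * (e t * (t - y0))
        + (b s - b s') * (K * \<eta>' (s - s')) + 4 * M * (b s * (s - x0)) + 4 * M * (b s' * (s' - x0))"
      unfolding eqs by (simp add: algebra_simps)
    also have "\<dots> \<le> (- 2 * K * exp (2 - (s - s')) + 8 * M) + 4 * M + 4 * M * 1
        + 2 * (K * \<eta>' (s - s')) + 4 * M * 1 + 4 * M * 1"
      using 1(2) 2(2) 3(2) M0 K0 \<eta>'s bb prod b e S
      by (intro add_mono mult_left_mono mult_right_mono) auto
    also have "\<dots> = - 2 * K + 24 * M" by (simp add: \<eta>'_def algebra_simps)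
    also have "\<dots> < - 2 * N" using M0 by (simp add: K_def)
    finally show False by simp
  qed
  \<comment> \<open>Setting \<open>x' = x0\<close> and \<open>y = y0\<close> in \<open>main\<close>
    gives \<open>h \<ge> 0\<close> on \<open>[x0, x0 + 1]\<close>. Since \<open>h x0 = 0\<close>,
    its derivative at \<open>x0\<close> is nonnegative, and this is the gradient bound.\<close>
  define h where "h x = K * \<eta> (x - x0) + 2 * M * (x - x0)^2 - (f x y0 - f x0 y0)" for x
  have h_nonneg: "h x \<ge> 0" if "x0 \<le> x" "x \<le> x0 + 1" for x
    using Gmax[of x0 x y0] that main by (auto simp: h_def G_def \<psi>_def)
  have "(h has_real_derivative K * \<eta>' (x0 - x0) - fx x0 y0) (at x0)"
    unfolding h_def
    by (auto intro!: eq_intros)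
  then have hd: "(h has_real_derivative K * (exp 2 - 1) - fx x0 y0) (at x0)" by (simp add: \<eta>'_def)
  have "K * (exp 2 - 1) - fx x0 y0 \<ge> 0"
  proof (rule ccontr)
    assume "\<not> ?thesis"
    then obtain d where d: "d > 0" "\<And>x. 0 < x \<Longrightarrow> x < d \<Longrightarrow> h (x0 + x) < h x0"
      using DERIV_neg_dec_right[OF hd] by auto
    have "h (x0 + min (d/2) 1) < h x0" using d by (intro d(2)) auto
    moreover have "h x0 = 0" by (simp add: h_def \<eta>_def)
    ultimately show False using h_nonneg[of "x0 + min (d/2) 1"] d by auto
  qed
  moreover have "exp 2 - 1 \<le> (7::real)"
  proof -
    have "exp (2::real) = (exp 1)^2" by (simp flip: exp_of_nat_mult)
    also have "\<dots> \<le> (14/5)^2" using exp_le e_less_272 by (intro power_mono) auto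
    finally show ?thesis by (simp add: power2_eq_square)
  qed
  ultimately have "fx x0 y0 \<le> K * 7"
    using mult_left_mono[of "exp 2 - 1" 7 K] K0 by linarith
  then show ?thesis by (simp add: K_def)
qed

lemma doubling_gradient_bound_abs:
  fixes f fx fy fxx fyy :: "real \<Rightarrow> real \<Rightarrow> real" and b e :: "real \<Rightarrow> real"
  assumes cont: "continuous_on ({x0-1..x0+1} \<times> {y0-1..y0+1}) (\<lambda>(x, y). f x y)"
    and fx: "\<And>x y. \<bar>x - x0\<bar> \<le> 1 \<Longrightarrow> \<bar>y - y0\<bar> \<le> 1 \<Longrightarrow> ((\<lambda>x. f x y) has_real_derivative fx x y) (at x)"
    and fxx: "\<And>x y. \<bar>x - x0\<bar> \<le> 1 \<Longrightarrow> \<bar>y - y0\<bar> \<le> 1 \<Longrightarrow> ((\<lambda>x. fx x y) has_real_derivative fxx x y) (at x)"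
    and fy: "\<And>x y. \<bar>x - x0\<bar> \<le> 1 \<Longrightarrow> \<bar>y - y0\<bar> \<le> 1 \<Longrightarrow> (f x has_real_derivative fy x y) (at y)"
    and fyy: "\<And>x y. \<bar>x - x0\<bar> \<le> 1 \<Longrightarrow> \<bar>y - y0\<bar> \<le> 1 \<Longrightarrow> (fy x has_real_derivative fyy x y) (at y)"
    and M: "\<And>x y. \<bar>x - x0\<bar> \<le> 1 \<Longrightarrow> \<bar>y - y0\<bar> \<le> 1 \<Longrightarrow> \<bar>f x y\<bar> \<le> M" and M0: "M > 0"
    and N: "\<And>x y. \<bar>x - x0\<bar> \<le> 1 \<Longrightarrow> \<bar>y - y0\<bar> \<le> 1 \<Longrightarrow>
      \<bar>fxx x y + b x * fx x y + fyy x y + e y * fy x y\<bar> \<le> N"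
    and b: "\<And>x. \<bar>x - x0\<bar> \<le> 1 \<Longrightarrow> \<bar>b x\<bar> \<le> 1" and e: "\<And>y. \<bar>y - y0\<bar> \<le> 1 \<Longrightarrow> \<bar>e y\<bar> \<le> 1"
  shows "\<bar>fx x0 y0\<bar> \<le> 7 * (N + 13 * M)"
proof -
  have "fx x0 y0 \<le> 7 * (N + 13 * M)"
    by (rule doubling_gradient_bound[OF cont fx fxx fy fyy M M0 N b e])
  moreover have "- fx x0 y0 \<le> 7 * (N + 13 * M)"
  proof (rule doubling_gradient_bound[where f = "\<lambda>x y. - f x y" and fx = "\<lambda>x y. - fx x y"
      and fy = "\<lambda>x y. - fy x y" and fxx = "\<lambda>x y. - fxx x y" and fyy = "\<lambda>x y. - fyy x y"
      and b = b and e = e, OF _ DERIV_minus[OF fx] DERIV_minus[OF fxx] DERIV_minus[OF fy] DERIV_minus[OF fyy] _ M0 _ b e])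
    show "continuous_on ({x0-1..x0+1} \<times> {y0-1..y0+1}) (\<lambda>(x, y). - f x y)"
      using continuous_on_minus[OF cont] by (simp add: split_beta)
    fix x y assume xy: "\<bar>x - x0\<bar> \<le> 1" "\<bar>y - y0\<bar> \<le> 1"
    show "\<bar>- f x y\<bar> \<le> M" using M[OF xy] by simp
    have "- fxx x y + b x * - fx x y + - fyy x y + e y * - fy x y
        = - (fxx x y + b x * fx x y + fyy x y + e y * fy x y)" by simp
    then show "\<bar>- fxx x y + b x * - fx x y + - fyy x y + e y * - fy x y\<bar> \<le> N"
      using N[OF xy] by (simp only: abs_minus_cancel)
  qed
  ultimately show ?thesis by simp
qed

text \<open>The comparison function \<open>B * (cosh ((r - r0) / 2) + cosh ((z - z0) / 2))\<close>
  is at least 1 on the boundary of the box. As \<open>r \<ge> 1\<close> there, the drift adds at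
  most 1/2 to the radial coefficient 1/4, so the sum stays below 1 and the function is a
  supersolution; the rate 1/2 leaves room for this.\<close>

lemma exponential_decay_box:
  fixes m mr mz mrr mzz :: "real \<Rightarrow> real \<Rightarrow> real"
  assumes d: "d > 0" "r0 - d \<ge> 1"
    and cont: "continuous_on ({r0-d..r0+d} \<times> {z0-d..z0+d}) (\<lambda>(r, z). m r z)"
    and mr: "\<And>r z. r > 0 \<Longrightarrow> ((\<lambda>r. m r z) has_real_derivative mr r z) (at r)"
    and mrr: "\<And>r z. r > 0 \<Longrightarrow> ((\<lambda>r. mr r z) has_real_derivative mrr r z) (at r)"
    and mz: "\<And>r z. r > 0 \<Longrightarrow> (m r has_real_derivative mz r z) (at z)"
    and mzz: "\<And>r z. r > 0 \<Longrightarrow> (mz r has_real_derivative mzz r z) (at z)"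
    and le1: "\<And>r z. \<bar>r - r0\<bar> \<le> d \<Longrightarrow> \<bar>z - z0\<bar> \<le> d \<Longrightarrow> m r z \<le> 1"
    and sub: "\<And>r z. \<bar>r - r0\<bar> \<le> d \<Longrightarrow> \<bar>z - z0\<bar> \<le> d \<Longrightarrow> mzz r z + mrr r z + mr r z / r \<ge> m r z"
  shows "m r0 z0 \<le> 4 * exp (- d / 2)"
proof -
  define B where "B = 1 / cosh (d / 2)"
  have B: "B > 0" by (simp add: B_def cosh_real_pos)
  define g where "g r z = m r z - B * (cosh ((r - r0) / 2) + cosh ((z - z0) / 2))" for r z
  define gr where "gr r z = mr r z - B * (sinh ((r - r0) / 2) / 2)" for r z
  define gz where "gz r z = mz r z - B * (sinh ((z - z0) / 2) / 2)" for r z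
  define grr where "grr r z = mrr r z - B * (cosh ((r - r0) / 2) / 4)" for r z
  define gzz where "gzz r z = mzz r z - B * (cosh ((z - z0) / 2) / 4)" for r z
  note eqi = derivative_eq_intros mr[THEN DERIV_cong] mrr[THEN DERIV_cong] mz[THEN DERIV_cong] mzz[THEN DERIV_cong]
  have one: "B * cosh (x / 2) \<ge> 1" if "\<bar>x\<bar> = d" for x
  proof -
    have "x = d \<or> x = - d" using that d by auto
    then have "cosh (x / 2) = cosh (d / 2)" using cosh_minus[of "d/2"] by auto
    moreover have "B * cosh (d / 2) = 1" by (simp add: B_def)
    ultimately show ?thesis by (metis order_refl)
  qed
  have "g r0 z0 \<le> 0"
  proof (rule maximum_principle_rectangle[where g = g and gx = gr and gy = gz and gxx = grr and gyy = gzz])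
    show "continuous_on ({r0-d..r0+d} \<times> {z0-d..z0+d}) (\<lambda>(x, y). g x y)"
      using cont unfolding g_def split_beta by (auto intro!: continuous_intros)
    fix r z assume rz: "r0 - d < r" "r < r0 + d" "z0 - d < z" "z < z0 + d"
    then have r: "r > 0" using d by simp
    show "((\<lambda>x. g x z) has_real_derivative gr r z) (at r)"
      using r unfolding g_def gr_def by (auto intro!: eqi)
    show "((\<lambda>x. gr x z) has_real_derivative grr r z) (at r)"
      using r unfolding gr_def grr_def by (auto intro!: eqi)
    show "(g r has_real_derivative gz r z) (at z)"
      using r unfolding g_def gz_def by (auto intro!: eqi)
    show "(gz r has_real_derivative gzz r z) (at z)"
      using r unfolding gz_def gzz_def by (auto intro!: eqi)
    assume pos: "g r z > 0" and crit: "gr r z = 0" "gz r z = 0" "grr r z \<le> 0" "gzz r z \<le> 0"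
    have "mrr r z \<le> B * (cosh ((r - r0) / 2) / 4)" "mzz r z \<le> B * (cosh ((z - z0) / 2) / 4)"
      using crit by (auto simp: grr_def gzz_def)
    moreover have "mr r z / r \<le> B * (cosh ((r - r0) / 2) / 2)"
    proof -
      have "mr r z = B * (sinh ((r - r0) / 2) / 2)" using crit(1) unfolding gr_def by linarith
      then have "mr r z / r = B * (sinh ((r - r0) / 2) / 2) / r" by (rule arg_cong)
      also have "\<dots> \<le> B * (cosh ((r - r0) / 2) / 2) / r"
        using B r by (intro divide_right_mono mult_left_mono sinh_le_cosh_real) auto
      also have "\<dots> \<le> B * (cosh ((r - r0) / 2) / 2) / 1"
        using B rz d by (intro divide_left_mono) (auto intro!: mult_nonneg_nonneg)
      finally show ?thesis by simp
    qed
    moreover have "m r z \<le> mzz r z + mrr r z + mr r z / r"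
      using rz by (intro sub) auto
    ultimately have "m r z \<le> B * (cosh ((z - z0) / 2) / 4) + B * (3 / 4 * cosh ((r - r0) / 2))"
      by simp
    moreover have "m r z > B * cosh ((r - r0) / 2) + B * cosh ((z - z0) / 2)"
      using pos by (simp add: g_def algebra_simps)
    moreover have "B * cosh ((r - r0) / 2) > 0" "B * cosh ((z - z0) / 2) > 0"
      using B by (simp_all add: cosh_real_pos)
    ultimately show False by simp
  next
    fix r z assume rz: "r0 - d \<le> r" "r \<le> r0 + d" "z0 - d \<le> z" "z \<le> z0 + d"
      "r = r0 - d \<or> r = r0 + d \<or> z = z0 - d \<or> z = z0 + d"
    then have "\<bar>r - r0\<bar> = d \<or> \<bar>z - z0\<bar> = d" using d by auto
    moreover have "B * cosh ((r - r0) / 2) > 0" "B * cosh ((z - z0) / 2) > 0"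
      using B by (simp_all add: cosh_real_pos)
    ultimately have "B * cosh ((r - r0) / 2) + B * cosh ((z - z0) / 2) \<ge> 1"
      using one[of "r - r0"] one[of "z - z0"] by auto
    moreover have "m r z \<le> 1" using rz by (intro le1) auto
    ultimately show "g r z \<le> 0" by (simp add: g_def algebra_simps)
  qed (use d in auto)
  then have "m r0 z0 \<le> 2 * B" by (simp add: g_def)
  also have "\<dots> \<le> 4 * exp (- d / 2)"
  proof -
    have "exp (d / 2) \<le> 2 * cosh (d / 2)" by (simp add: cosh_def)
    then have "2 * B \<le> 4 / exp (d / 2)"
      by (simp add: B_def divide_simps cosh_real_pos)
    moreover have "exp (- d / 2) = 1 / exp (d / 2)"
      using exp_minus[of "d / 2"] by (simp add: inverse_eq_divide)
    ultimately show ?thesis by simp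
  qed
  finally show ?thesis .
qed

section \<open>Differentiation under the integral sign and mixed derivatives\<close>

text \<open>The integral is the function of \<open>(s, y)\<close> given by integrating
  \<open>g s\<close> over \<open>{0..y}\<close>, restricted to the diagonal. The
  \<open>s\<close>-derivative and the continuous \<open>y\<close>-derivative \<open>g s y\<close>
  give total differentiability, and the chain rule along \<open>s = y\<close> adds the two.\<close>

lemma leibniz_rule_diagonal:
  fixes g g' :: "real \<Rightarrow> real \<Rightarrow> real"
  assumes g: "\<And>r z. r > 0 \<Longrightarrow> ((\<lambda>s. g s z) has_real_derivative g' r z) (at r)"
    and cont: "continuous_on ({0<..} \<times> UNIV) (\<lambda>(r, z). g r z)"
    and cont': "continuous_on ({0<..} \<times> UNIV) (\<lambda>(r, z). g' r z)"
    and r: "r > 0"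
  shows "((\<lambda>r. integral {0..r} (g r)) has_real_derivative integral {0..r} (g' r) + g r r) (at r)"
proof -
  have cont1: "continuous_on A (g s)" if "s > 0" for s A
    by (rule continuous_on_compose2[OF cont, where f="\<lambda>z. (s, z)", unfolded case_prod_conv])
      (use that in \<open>auto intro!: continuous_intros\<close>)
  have dx: "((\<lambda>s. integral {0..r} (g s)) has_derivative (\<lambda>t. integral {0..r} (g' r) * t)) (at r within {0<..})"
  proof -
    have "((\<lambda>s. integral (cbox 0 r) (g s)) has_field_derivative integral (cbox 0 r) (g' r)) (at r within {0<..})"
    proof (rule leibniz_rule_field_derivative)
      show "((\<lambda>x. g x t) has_real_derivative g' x t) (at x within {0<..})" if "x \<in> {0<..}" "t \<in> cbox 0 r" for x t
        using g[of x t] that by (auto intro: DERIV_subset)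
      show "g x integrable_on cbox 0 r" if "x \<in> {0<..}" for x
        using that by (intro integrable_continuous cont1) auto
      show "continuous_on ({0<..} \<times> cbox 0 r) (\<lambda>(x, t). g' x t)"
        using cont' by (rule continuous_on_subset) auto
    qed (use r in auto)
    then show ?thesis by (simp add: has_field_derivative_def)
  qed
  have dy: "((\<lambda>y. integral {0..y} (g s)) has_derivative blinfun_apply (blinfun_mult_right (g s y))) (at y within {0<..})"
    if "s \<in> {0<..}" "y \<in> {0<..}" for s y
  proof -
    have "((\<lambda>y. integral {0..y} (g s)) has_real_derivative g s y) (at y within {0..y+1})"
      by (rule integral_has_real_derivative) (use that cont1 in auto)
    then have "((\<lambda>y. integral {0..y} (g s)) has_real_derivative g s y) (at y)"
      using that by (subst (asm) at_within_interior) auto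
    then show ?thesis
      by (auto simp: has_field_derivative_def intro: has_derivative_at_withinI)
  qed
  have "((\<lambda>(s, y). integral {0..y} (g s)) has_derivative
      (\<lambda>(tx, ty). integral {0..r} (g' r) * tx + blinfun_mult_right (g r r) ty)) (at (r, r) within {0<..} \<times> {0<..})"
  proof (rule has_derivative_partialsI[OF dx dy])
    have "continuous_on ({0<..} \<times> {0<..}) (\<lambda>(s, y). blinfun_mult_right (g s y))"
      using continuous_on_subset[OF cont, of "{0<..} \<times> {0<..}"]
      by (auto simp: split_beta intro!: continuous_intros)
    then show "continuous (at (r, r) within {0<..} \<times> {0<..}) (\<lambda>(s, y). blinfun_mult_right (g s y))"
      using r by (simp add: continuous_on_eq_continuous_within)
  qed (use r in auto)
  moreover have "at (r, r) within {0<..} \<times> {0<..} = at (r, r)"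
    using r by (intro at_within_open open_Times) auto
  ultimately have D: "((\<lambda>(s, y). integral {0..y} (g s)) has_derivative
      (\<lambda>(tx, ty). integral {0..r} (g' r) * tx + g r r * ty)) (at (r, r))"
    by simp
  have "((\<lambda>s. (s, s)) has_derivative (\<lambda>t. (t, t))) (at r)"
    by (auto intro!: derivative_eq_intros)
  from has_derivative_compose[OF this D]
  have "((\<lambda>s. integral {0..s} (g s)) has_derivative (\<lambda>t. integral {0..r} (g' r) * t + g r r * t)) (at r)"
    by simp
  moreover have "(\<lambda>t. integral {0..r} (g' r) * t + g r r * t) = (*) (integral {0..r} (g' r) + g r r)"
    by (simp add: fun_eq_iff distrib_right)
  ultimately show ?thesis by (simp add: has_field_derivative_def)
qed

text \<open>Continuity of \<open>frz\<close> allows \<open>f s y - f s (z - 1)\<close>, the integral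
  of \<open>fz s\<close>, to be differentiated in \<open>s\<close> under the integral sign. The
  resulting formula for \<open>fr r y\<close> is then differentiated in \<open>y\<close>. The base
  point \<open>z - 1\<close> is an arbitrary point below \<open>z\<close>.\<close>

lemma mixed_partial_derivatives_eq:
  fixes f fr fz frz fzr :: "real \<Rightarrow> real \<Rightarrow> real"
  assumes fz: "\<And>r z. r > 0 \<Longrightarrow> (f r has_real_derivative fz r z) (at z)"
    and fr: "\<And>r z. r > 0 \<Longrightarrow> ((\<lambda>s. f s z) has_real_derivative fr r z) (at r)"
    and frz: "\<And>r z. r > 0 \<Longrightarrow> ((\<lambda>s. fz s z) has_real_derivative frz r z) (at r)"
    and fzr: "\<And>r z. r > 0 \<Longrightarrow> (fr r has_real_derivative fzr r z) (at z)"
    and cont_z: "continuous_on ({0<..} \<times> UNIV) (\<lambda>(r, z). fz r z)"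
    and cont: "continuous_on ({0<..} \<times> UNIV) (\<lambda>(r, z). frz r z)"
    and r: "r > 0"
  shows "fzr r z = frz r z"
proof -
  have cont1: "continuous_on A (fz s)" if "s > 0" for s A
    by (rule continuous_on_compose2[OF cont_z, where f="\<lambda>z. (s, z)", unfolded case_prod_conv])
      (use that in \<open>auto intro!: continuous_intros\<close>)
  have cont2: "continuous_on A (frz s)" if "s > 0" for s A
    by (rule continuous_on_compose2[OF cont, where f="\<lambda>z. (s, z)", unfolded case_prod_conv])
      (use that in \<open>auto intro!: continuous_intros\<close>)
  have eq: "fr r y - fr r (z - 1) = integral {z-1..y} (frz r)" if "y \<ge> z - 1" for y
  proof -
    have "((\<lambda>s. integral (cbox (z-1) y) (fz s)) has_field_derivative integral (cbox (z-1) y) (frz r)) (at r within {0<..})"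
    proof (rule leibniz_rule_field_derivative)
      show "((\<lambda>x. fz x t) has_real_derivative frz x t) (at x within {0<..})" if "x \<in> {0<..}" for x t
        using frz[of x t] that by (auto intro: DERIV_subset)
      show "fz x integrable_on cbox (z-1) y" if "x \<in> {0<..}" for x
        using that by (intro integrable_continuous cont1) auto
      show "continuous_on ({0<..} \<times> cbox (z-1) y) (\<lambda>(x, t). frz x t)"
        using cont by (rule continuous_on_subset) auto
    qed (use r in auto)
    then have "((\<lambda>s. integral {z-1..y} (fz s)) has_field_derivative integral {z-1..y} (frz r)) (at r)"
      using r by (subst (asm) at_within_open) auto
    moreover have "((\<lambda>s. f s y - f s (z-1)) has_field_derivative fr r y - fr r (z-1)) (at r)"
      by (intro DERIV_diff fr r)
    then have "((\<lambda>s. integral {z-1..y} (fz s)) has_field_derivative fr r y - fr r (z-1)) (at r)"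
    proof (rule DERIV_cong_ev[THEN iffD1, rotated -1])
      show "\<forall>\<^sub>F s in nhds r. f s y - f s (z-1) = integral {z-1..y} (fz s)"
        using eventually_nhds_in_open[OF open_greaterThan, of r 0, unfolded greaterThan_iff, OF r]
      proof (rule eventually_mono)
        fix s :: real assume s: "s > 0"
        have "(fz s has_integral f s y - f s (z-1)) {z-1..y}"
          using that s fz by (intro fundamental_theorem_of_calculus)
            (auto simp flip: has_real_derivative_iff_has_vector_derivative intro: DERIV_subset)
        then show "f s y - f s (z-1) = integral {z-1..y} (fz s)" by (simp add: integral_unique)
      qed
    qed auto
    ultimately show ?thesis using DERIV_unique by blast
  qed
  have z1: "z - 1 < z" by simp
  have "((\<lambda>y. integral {z-1..y} (frz r)) has_real_derivative frz r z) (at z within {z-1..z+1})"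
    by (rule integral_has_real_derivative) (use r cont2 in auto)
  then have "((\<lambda>y. integral {z-1..y} (frz r)) has_real_derivative frz r z) (at z)"
    by (subst (asm) at_within_interior) auto
  from DERIV_add[OF DERIV_const this, of "fr r (z-1)"]
  have "((\<lambda>y. fr r (z-1) + integral {z-1..y} (frz r)) has_real_derivative frz r z) (at z)"
    by simp
  then have "(fr r has_real_derivative frz r z) (at z)"
  proof (rule DERIV_cong_ev[THEN iffD1, rotated -1])
    show "\<forall>\<^sub>F y in nhds z. fr r (z-1) + integral {z-1..y} (frz r) = fr r y"
      using eventually_nhds_in_open[OF open_greaterThan, of z "z - 1", unfolded greaterThan_iff, OF z1]
    proof (rule eventually_mono)
      fix y assume "z - 1 < y"
      then show "fr r (z-1) + integral {z-1..y} (frz r) = fr r y"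
        using eq[of y] by linarith
    qed
  qed auto
  then show ?thesis using fzr[OF r] DERIV_unique by blast
qed

section \<open>Two-end profiles\<close>

text \<open>Restates a two-end solution on \<open>r > 0\<close> with named derivatives. The single
  function \<open>urz\<close> for both mixed derivatives records their equality, and
  \<open>asymp\<close> replaces the essential supremum by a pointwise uniform bound.\<close>

locale two_end_profile =
  fixes u ur uz urr uzz urz :: "real \<Rightarrow> real \<Rightarrow> real" and k c :: real
  assumes deriv_u_r: "\<And>r z. r > 0 \<Longrightarrow> ((\<lambda>s. u s z) has_real_derivative ur r z) (at r)"
    and deriv_u_z: "\<And>r z. r > 0 \<Longrightarrow> (u r has_real_derivative uz r z) (at z)"
    and deriv_ur_r: "\<And>r z. r > 0 \<Longrightarrow> ((\<lambda>s. ur s z) has_real_derivative urr r z) (at r)"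
    and deriv_ur_z: "\<And>r z. r > 0 \<Longrightarrow> (ur r has_real_derivative urz r z) (at z)"
    and deriv_uz_r: "\<And>r z. r > 0 \<Longrightarrow> ((\<lambda>s. uz s z) has_real_derivative urz r z) (at r)"
    and deriv_uz_z: "\<And>r z. r > 0 \<Longrightarrow> (uz r has_real_derivative uzz r z) (at z)"
    and cont_u: "continuous_on ({0<..} \<times> UNIV) (\<lambda>(r, z). u r z)"
    and cont_ur: "continuous_on ({0<..} \<times> UNIV) (\<lambda>(r, z). ur r z)"
    and cont_uz: "continuous_on ({0<..} \<times> UNIV) (\<lambda>(r, z). uz r z)"
    and cont_urr: "continuous_on ({0<..} \<times> UNIV) (\<lambda>(r, z). urr r z)"
    and cont_urz: "continuous_on ({0<..} \<times> UNIV) (\<lambda>(r, z). urz r z)"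
    and pde: "\<And>r z. r > 0 \<Longrightarrow> uzz r z + urr r z + ur r z / r + u r z - (u r z)^3 = 0"
    and even: "\<And>r z. r > 0 \<Longrightarrow> u r (- z) = u r z"
    and bounded: "\<And>r z. r > 0 \<Longrightarrow> \<bar>u r z\<bar> < 1"
    and k: "0 < k" "k \<le> sqrt 2 / 2"
    and asymp: "\<And>\<epsilon>. \<epsilon> > 0 \<Longrightarrow> \<exists>R. \<forall>r\<ge>R. \<forall>z>0. \<bar>u r z - H (z - k * ln r + c)\<bar> \<le> \<epsilon>"

section \<open>From half-plane solutions to profiles\<close>

lemma continuous_on_pos_of_partials:
  fixes f fr fz :: "real \<Rightarrow> real \<Rightarrow> real"
  assumes fr: "\<And>r z. r > 0 \<Longrightarrow> ((\<lambda>s. f s z) has_real_derivative fr r z) (at r)"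
    and fz: "\<And>r z. r > 0 \<Longrightarrow> (f r has_real_derivative fz r z) (at z)"
    and cont: "continuous_on ({0<..} \<times> UNIV) (\<lambda>(r, z). fz r z)"
  shows "continuous_on ({0<..} \<times> UNIV) (\<lambda>(r, z). f r z)"
proof -
  \<comment> \<open>Differentiability in each variable separately does not give joint continuity;
    together with continuity of the \<open>z\<close>-derivative it gives total
    differentiability.\<close>
  have "continuous (at (r, z) within {0<..} \<times> UNIV) (\<lambda>(r, z). f r z)" if r: "r > 0" for r z
  proof (rule has_derivative_continuous, rule has_derivative_partialsI)
    show "((\<lambda>x. f x z) has_derivative (*) (fr r z)) (at r within {0<..})"
      using fr[OF r] by (auto simp: has_field_derivative_def intro: has_derivative_at_withinI)
    show "(f x has_derivative blinfun_apply (blinfun_mult_right (fz x y))) (at y within UNIV)" if "x \<in> {0<..}" for x y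
      using fz that by (auto simp: has_field_derivative_def)
    have "continuous_on ({0<..} \<times> UNIV) (\<lambda>(s, y). blinfun_mult_right (fz s y))"
      using cont by (auto simp: split_beta intro!: continuous_intros)
    then show "continuous (at (r, z) within {0<..} \<times> UNIV) (\<lambda>(s, y). blinfun_mult_right (fz s y))"
      using r by (simp add: continuous_on_eq_continuous_within)
  qed auto
  then show ?thesis by (auto simp: continuous_on_eq_continuous_within)
qed

lemma C1_half_plane_deriv_r:
  assumes "C1_half_plane f" "r > 0"
  shows "((\<lambda>s. f s z) has_real_derivative d_r f r z) (at r)"
proof -
  have "(\<lambda>s. f s z) differentiable (at r within {0..})"
    using assms by (auto simp: C1_half_plane_def)
  then have "((\<lambda>s. f s z) has_vector_derivative d_r f r z) (at r within {0..})"
    by (simp add: vector_derivative_works d_r_def)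
  then show ?thesis
    using assms by (subst (asm) at_within_interior) (auto simp: has_real_derivative_iff_has_vector_derivative)
qed

lemma C1_half_plane_deriv_z:
  assumes "C1_half_plane f" "r > 0"
  shows "(f r has_real_derivative d_z f r z) (at z)"
  using assms by (auto simp: C1_half_plane_def d_z_def DERIV_deriv_iff_real_differentiable)

lemma continuous_H: "continuous_on A H"
  unfolding H_def[abs_def] by (intro continuous_intros) (auto simp: cosh_real_nonzero)

text \<open>A continuous function that exceeds \<open>\<epsilon>\<close> at one point exceeds it on
  a nonempty open set, which is not negligible. Hence a bound on the essential supremum holds at
  every \<open>z > 0\<close>.\<close>

lemma two_end_solution_imp_profile:
  assumes u: "two_end_solution k u" and k: "0 < k" "k \<le> sqrt 2 / 2"
  obtains c where "two_end_profile u (d_r u) (d_z u) (d_r (d_r u)) (d_z (d_z u)) (d_r (d_z u)) k c"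
proof -
  have C1: "C1_half_plane u" "C1_half_plane (d_r u)" "C1_half_plane (d_z u)"
    using u by (auto simp: two_end_solution_def axial_Allen_Cahn_solution_def C2_half_plane_def)
  obtain c where c: "((\<lambda>r. esssup (lebesgue_on {0<..}) (\<lambda>z. ereal \<bar>u r z - H (z - k * ln r + c)\<bar>)) \<longlongrightarrow> 0) at_top"
    using u by (auto simp: two_end_solution_def)
  \<comment> \<open>\<open>D(1)\<close> to \<open>D(3)\<close> are the \<open>r\<close>-derivatives
    of \<open>u\<close>, \<open>d_r u\<close> and \<open>d_z u\<close>; \<open>D(4)\<close> to
    \<open>D(6)\<close> are their \<open>z\<close>-derivatives.\<close>
  note D = C1[THEN C1_half_plane_deriv_r] C1[THEN C1_half_plane_deriv_z]
  have sub: "({0<..} :: real set) \<times> UNIV \<subseteq> ({0..} :: real set) \<times> (UNIV :: real set)" by auto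
  have cont: "continuous_on ({0<..} \<times> UNIV) (\<lambda>(r, z). d_r f r z)" "continuous_on ({0<..} \<times> UNIV) (\<lambda>(r, z). d_z f r z)"
    if "C1_half_plane f" for f
    using that unfolding C1_half_plane_def by (metis continuous_on_subset[OF _ sub])+
  have "two_end_profile u (d_r u) (d_z u) (d_r (d_r u)) (d_z (d_z u)) (d_r (d_z u)) k c"
  proof
    show "(d_r u r has_real_derivative d_r (d_z u) r z) (at z)" if "r > 0" for r z
      using mixed_partial_derivatives_eq[OF D(4) D(1) D(3) D(5) cont(2)[OF C1(1)] cont(1)[OF C1(3)] that]
        D(5)[OF that] by metis
    show "continuous_on ({0<..} \<times> UNIV) (\<lambda>(r, z). u r z)"
      by (rule continuous_on_pos_of_partials[OF D(1) D(4) cont(2)[OF C1(1)]])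
    show "\<exists>R. \<forall>r\<ge>R. \<forall>z>0. \<bar>u r z - H (z - k * ln r + c)\<bar> \<le> \<epsilon>" if \<epsilon>: "\<epsilon> > 0" for \<epsilon>
    proof -
      have "eventually (\<lambda>r. esssup (lebesgue_on {0<..}) (\<lambda>z. ereal \<bar>u r z - H (z - k * ln r + c)\<bar>) < ereal \<epsilon>) at_top"
        using order_tendstoD(2)[OF c, of "ereal \<epsilon>"] \<epsilon> by simp
      then obtain R where R: "\<And>r. r \<ge> R \<Longrightarrow> esssup (lebesgue_on {0<..}) (\<lambda>z. ereal \<bar>u r z - H (z - k * ln r + c)\<bar>) < ereal \<epsilon>"
        by (auto simp: eventually_at_top_linorder)
      have "\<bar>u r z - H (z - k * ln r + c)\<bar> \<le> \<epsilon>" if r: "r \<ge> max R 1" and z: "z > 0" for r z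
      proof (rule ccontr)
        assume neg: "\<not> ?thesis"
        define g where "g z = \<bar>u r z - H (z - k * ln r + c)\<bar>" for z
        have "continuous_on UNIV (u r)"
          using r by (intro DERIV_continuous_on[of _ _ "d_z u r"] DERIV_subset[OF D(4)]) auto
        then have cg: "continuous_on UNIV g"
          unfolding g_def by (auto intro!: continuous_intros continuous_on_compose2[OF continuous_H[of UNIV]])
        define S where "S = {z. g z > \<epsilon>} \<inter> {0<..}"
        have "open S" unfolding S_def by (intro open_Int open_Collect_less cg continuous_intros)
        moreover have "z \<in> S" using neg z by (auto simp: S_def g_def)
        ultimately have nonneg: "\<not> negligible S" using open_not_negligible by blast
        have "AE x in lebesgue_on {0<..}. ereal (g x) \<le> esssup (lebesgue_on {0<..}) (\<lambda>z. ereal (g z))"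
          by (rule esssup_AE)
        then have "AE x in lebesgue_on {0<..}. g x \<le> \<epsilon>"
        proof (rule AE_mp, intro AE_I2 impI)
          fix x assume "ereal (g x) \<le> esssup (lebesgue_on {0<..}) (\<lambda>z. ereal (g z))"
          also have "\<dots> < ereal \<epsilon>" using R r by (auto simp: g_def)
          finally show "g x \<le> \<epsilon>" by simp
        qed
        then have "AE x in lebesgue. x \<in> {0<..} \<longrightarrow> g x \<le> \<epsilon>"
          by (subst (asm) AE_restrict_space_iff) auto
        then have "negligible S"
          unfolding eventually_ae_filter negligible_iff_null_sets
          by (auto simp: S_def elim!: null_sets_completion_subset[rotated])
        with nonneg show False by simp
      qed
      then show ?thesis by blast
    qed
    show "d_z (d_z u) r z + d_r (d_r u) r z + d_r u r z / r + u r z - (u r z) ^ 3 = 0"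
      "u r (- z) = u r z" "\<bar>u r z\<bar> < 1" if "r > 0" for r z
      using u less_imp_le[OF that] that unfolding two_end_solution_def axial_Allen_Cahn_solution_def by metis+
    fix r z :: real assume r: "r > 0"
    show "((\<lambda>s. u s z) has_real_derivative d_r u r z) (at r)"
      "((\<lambda>s. d_r u s z) has_real_derivative d_r (d_r u) r z) (at r)"
      "((\<lambda>s. d_z u s z) has_real_derivative d_r (d_z u) r z) (at r)"
      "(u r has_real_derivative d_z u r z) (at z)"
      "(d_z u r has_real_derivative d_z (d_z u) r z) (at z)"
      by (rule D(1)[OF r] D(2)[OF r] D(3)[OF r] D(4)[OF r] D(6)[OF r])+
  qed (rule k cont(1)[OF C1(1)] cont(2)[OF C1(1)] cont(1)[OF C1(2)] cont(1)[OF C1(3)])+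
  then show thesis by (rule that)
qed

section \<open>Decay away from the interface\<close>

lemma H_deriv: "(H has_real_derivative (1 - (H x)^2) / sqrt 2) (at x)"
proof -
  have "((\<lambda>x. tanh (x / sqrt 2)) has_real_derivative (1 - (tanh (x / sqrt 2))^2) * (1 / sqrt 2)) (at x)"
  proof (rule DERIV_chain2[of tanh])
    show "((\<lambda>x. x / sqrt 2) has_real_derivative 1 / sqrt 2) (at x)"
      using DERIV_cdivide[OF DERIV_ident] by blast
  qed (auto intro!: derivative_eq_intros simp: cosh_real_nonzero)
  then show ?thesis unfolding H_def[abs_def] by simp
qed

lemma H_deriv2: "((\<lambda>x. (1 - (H x)^2) / sqrt 2) has_real_derivative (H x)^3 - H x) (at x)"
proof -
  have "((\<lambda>x. (1 - (H x)^2) * (1 / sqrt 2)) has_real_derivative (- (2 * H x * ((1 - (H x)^2) / sqrt 2))) * (1 / sqrt 2)) (at x)"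
    by (rule DERIV_cmult_right) (auto intro!: derivative_eq_intros H_deriv)
  moreover have "(- (2 * H x * ((1 - (H x)^2) / sqrt 2))) * (1 / sqrt 2) = (H x)^3 - H x"
  proof -
    have "(- (2 * H x * ((1 - (H x)^2) / sqrt 2))) * (1 / sqrt 2) = - (2 * H x * (1 - (H x)^2)) / (sqrt 2 * sqrt 2)"
      by simp
    also have "\<dots> = (H x)^3 - H x"
      by (simp add: field_simps power2_eq_square power3_eq_cube)
    finally show ?thesis .
  qed
  ultimately show ?thesis by simp
qed

lemma abs_H_less_1: "\<bar>H x\<bar> < 1"
  using tanh_real_bounds[of "x / sqrt 2"] by (auto simp: H_def abs_less_iff)

lemma H_minus: "H (- x) = - H x"
  by (simp add: H_def)

lemma H_close_to_1:
  assumes "\<epsilon> > 0"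
  obtains A where "A \<ge> 0" "\<And>x. x \<ge> A \<Longrightarrow> 1 - H x \<le> \<epsilon>" "\<And>x. x \<le> - A \<Longrightarrow> 1 + H x \<le> \<epsilon>"
proof -
  have "filterlim (\<lambda>x. x / sqrt 2) at_top (at_top :: real filter)"
    using filterlim_tendsto_pos_mult_at_top[OF tendsto_const[of "1 / sqrt 2"] _ filterlim_ident]
    by simp
  then have "(H \<longlongrightarrow> 1) at_top"
    unfolding H_def[abs_def] by (rule filterlim_compose[OF tanh_real_at_top])
  from order_tendstoD(1)[OF this, of "1 - \<epsilon>"] assms
  obtain A where A: "\<And>x. x \<ge> A \<Longrightarrow> H x > 1 - \<epsilon>" by (auto simp: eventually_at_top_linorder)
  show thesis
  proof (rule that[of "max A 0"])
    show "1 + H x \<le> \<epsilon>" if "x \<le> - max A 0" for x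
      using A[of "- x"] that H_minus[of x] by linarith
    show "1 - H x \<le> \<epsilon>" if "x \<ge> max A 0" for x
      using A[of x] that by simp
  qed simp
qed

section \<open>Position of the interface and decay towards the pure phases\<close>

context two_end_profile
begin

definition q :: "real \<Rightarrow> real" where "q r = k * ln r - c"

lemma k_less_1: "k < 1"
proof -
  have "sqrt 2 < 2" by (rule real_less_lsqrt) auto
  then show ?thesis using k by simp
qed

text \<open>This is \<open>ln x \<le> x - 1\<close> at \<open>x = s / r\<close> combined with
  \<open>k < 1\<close>. It keeps the interface height within \<open>d\<close> of its central value
  over a radial distance \<open>d\<close> at radii at least 1.\<close>

lemma q_diff_le:
  assumes "0 < r" "0 < s"
  shows "q s - q r \<le> \<bar>s - r\<bar> / r"
proof -
  have "q s - q r = k * ln (s / r)" using assms by (simp add: q_def ln_div algebra_simps)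
  also have "\<dots> \<le> k * \<bar>s / r - 1\<bar>"
    using k ln_le_minus_one[of "s / r"] assms by (intro mult_left_mono order.trans[OF _ abs_ge_self]) auto
  also have "\<dots> \<le> 1 * \<bar>s / r - 1\<bar>" using k k_less_1 by (intro mult_right_mono) auto
  also have "\<dots> = \<bar>s - r\<bar> / r" using assms by (simp add: field_simps abs_if)
  finally show ?thesis .
qed

text \<open>A logarithm eventually exceeds every constant and stays below every line. The slope 1/32
  yields \<open>q (2 * r) \<le> r / 16\<close>, half of the height \<open>r / 8\<close> allowed in
  \<open>axis_lower_bound\<close>.\<close>

lemma eventually_q:
  obtains R where "R \<ge> 1" "\<And>r. r \<ge> R \<Longrightarrow> B \<le> q r" "\<And>r. r \<ge> R \<Longrightarrow> q r \<le> r / 32"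
proof -
  have "filterlim q at_top at_top"
  proof -
    have "filterlim (\<lambda>r. - c + k * ln r) at_top at_top"
      by (intro filterlim_tendsto_add_at_top[OF tendsto_const]
        filterlim_tendsto_pos_mult_at_top[OF tendsto_const k(1) ln_at_top])
    then show ?thesis by (simp add: q_def[abs_def])
  qed
  then have "eventually (\<lambda>r. B \<le> q r) at_top" by (simp add: filterlim_at_top)
  moreover have "eventually (\<lambda>r. q r \<le> r / 32) at_top"
  proof -
    have "((\<lambda>r::real. 1 / r) \<longlongrightarrow> 0) at_top"
      using tendsto_inverse_0_at_top[OF filterlim_ident] by (simp add: inverse_eq_divide)
    then have "((\<lambda>r. k * (ln r / r) - c * (1 / r)) \<longlongrightarrow> k * 0 - c * 0) at_top"
      by (intro tendsto_diff tendsto_mult tendsto_const ln_x_over_x_tendsto_0)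
    from order_tendstoD(2)[OF this, of "1/32"]
    have "eventually (\<lambda>r. k * (ln r / r) - c * (1 / r) < 1 / 32) at_top" by simp
    with eventually_gt_at_top[of 0] show ?thesis
      by eventually_elim (simp add: q_def field_simps)
  qed
  ultimately have "eventually (\<lambda>r. B \<le> q r \<and> q r \<le> r / 32) at_top" by eventually_elim simp
  then obtain R where "\<And>r. r \<ge> R \<Longrightarrow> B \<le> q r \<and> q r \<le> r / 32" by (auto simp: eventually_at_top_linorder)
  then show thesis by (intro that[of "max R 1"]) auto
qed

lemma continuous_on_u: "r > 0 \<Longrightarrow> continuous_on A (u r)"
  by (intro DERIV_continuous_on[of _ _ "uz r"] DERIV_subset[OF deriv_u_z]) auto

lemma asymp_closed:
  assumes "\<epsilon> > 0"
  obtains R where "R \<ge> 1" "\<And>r z. r \<ge> R \<Longrightarrow> z \<ge> 0 \<Longrightarrow> \<bar>u r z - H (z - q r)\<bar> \<le> \<epsilon>"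
proof -
  obtain R where R: "\<And>r z. r \<ge> R \<Longrightarrow> z > 0 \<Longrightarrow> \<bar>u r z - H (z - q r)\<bar> \<le> \<epsilon>"
    using asymp[OF assms] by (auto simp: q_def algebra_simps)
  show thesis
  proof (rule that[of "max R 1"])
    fix r z :: real assume r: "r \<ge> max R 1" and z: "z \<ge> 0"
    show "\<bar>u r z - H (z - q r)\<bar> \<le> \<epsilon>"
    proof (rule continuous_le_on_closure[where S = "{0<..}" and f = "\<lambda>z. \<bar>u r z - H (z - q r)\<bar>"])
      show "continuous_on (closure {0<..}) (\<lambda>z. \<bar>u r z - H (z - q r)\<bar>)"
        using r by (auto intro!: continuous_intros continuous_on_u continuous_on_compose2[OF continuous_H[of UNIV]])
      show "z \<in> closure {0<..}" using z by simp
    qed (use R r in auto)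
  qed simp
qed

text \<open>From the factorisation \<open>u - u^3 = - u * (u - 1) * (u + 1)\<close>: near either
  phase the nonlinearity is controlled by the distance to that phase, in the form that
  \<open>gradient_bound\<close> takes as input.\<close>

lemma abs_nonlinearity_le:
  assumes r: "r > 0"
  shows "\<bar>u r z - (u r z)^3\<bar> \<le> 2 * \<bar>u r z - 1\<bar>" "\<bar>u r z - (u r z)^3\<bar> \<le> 2 * \<bar>u r z + 1\<bar>"
    "\<bar>u r z - (u r z)^3\<bar> \<le> 2"
proof -
  have b: "\<bar>u r z\<bar> \<le> 1" using bounded[OF r, of z] by simp
  have 1: "\<bar>u r z * (u r z + 1)\<bar> \<le> 2" "\<bar>u r z * (u r z - 1)\<bar> \<le> 2"
    using mult_mono[OF b, of "\<bar>u r z + 1\<bar>" 2] mult_mono[OF b, of "\<bar>u r z - 1\<bar>" 2] b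
    by (auto simp: abs_mult)
  have e1: "u r z - (u r z)^3 = (u r z * (u r z + 1)) * - (u r z - 1)"
    and e2: "u r z - (u r z)^3 = (u r z * (u r z - 1)) * - (u r z + 1)"
    by (simp_all add: algebra_simps power3_eq_cube)
  show "\<bar>u r z - (u r z)^3\<bar> \<le> 2 * \<bar>u r z - 1\<bar>"
    unfolding e1 abs_mult abs_minus_cancel using mult_right_mono[OF 1(1), of "\<bar>u r z - 1\<bar>"] by (simp add: abs_mult)
  show "\<bar>u r z - (u r z)^3\<bar> \<le> 2 * \<bar>u r z + 1\<bar>"
    unfolding e2 abs_mult abs_minus_cancel using mult_right_mono[OF 1(2), of "\<bar>u r z + 1\<bar>"] by (simp add: abs_mult)
  show "\<bar>u r z - (u r z)^3\<bar> \<le> 2"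
    using b power_le_one[of "\<bar>u r z\<bar>" 3] abs_triangle_ineq4[of "u r z" "(u r z)^3"] by (simp add: power_abs)
qed

text \<open>Here \<kappa> selects the phase. The deviation \<open>m = 1 - \<kappa> * u\<close> has
  Laplacian \<open>m * (1 - m) * (2 - m)\<close>, and for \<open>m \<le> 3 / 10\<close> the product
  of the last two factors is at least \<open>7/10 * 17/10 > 1\<close>, so
  \<open>exponential_decay_box\<close> applies.\<close>

lemma decay_from_box:
  assumes \<kappa>: "\<kappa> = 1 \<or> \<kappa> = -1" and d: "d > 0" "r0 - d \<ge> 1"
    and small: "\<And>r z. \<bar>r - r0\<bar> \<le> d \<Longrightarrow> \<bar>z - z0\<bar> \<le> d \<Longrightarrow> 1 - \<kappa> * u r z \<le> 3 / 10"
  shows "1 - \<kappa> * u r0 z0 \<le> 4 * exp (- d / 2)"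
proof (rule exponential_decay_box[where m = "\<lambda>r z. 1 - \<kappa> * u r z" and mr = "\<lambda>r z. - \<kappa> * ur r z" and mz = "\<lambda>r z. - \<kappa> * uz r z"
      and mrr = "\<lambda>r z. - \<kappa> * urr r z" and mzz = "\<lambda>r z. - \<kappa> * uzz r z", OF d])
  show "continuous_on ({r0-d..r0+d} \<times> {z0-d..z0+d}) (\<lambda>(r, z). 1 - \<kappa> * u r z)"
  proof -
    have "{r0-d..r0+d} \<times> {z0-d..z0+d} \<subseteq> {0<..} \<times> UNIV" using d by auto
    from continuous_on_subset[OF cont_u this] show ?thesis
      unfolding split_beta by (intro continuous_intros)
  qed
  fix r z assume rz: "\<bar>r - r0\<bar> \<le> d" "\<bar>z - z0\<bar> \<le> d"
  then have r: "r > 0" using d by linarith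
  define m where "m = 1 - \<kappa> * u r z"
  have m: "0 \<le> m" "m \<le> 3 / 10"
    using small[OF rz] bounded[OF r, of z] \<kappa> by (auto simp: m_def)
  then show "1 - \<kappa> * u r z \<le> 1" by (simp add: m_def)
  have "m * 1 \<le> m * ((1 - m) * (2 - m))"
  proof (rule mult_left_mono)
    have "(7/10) * (17/10) \<le> (1 - m) * (2 - m)" using m by (intro mult_mono) auto
    then show "1 \<le> (1 - m) * (2 - m)" by simp
  qed (use m in auto)
  also have "\<dots> = \<kappa> * (u r z - (u r z)^3)"
    using \<kappa> by (auto simp: m_def algebra_simps power3_eq_cube)
  also have "u r z - (u r z)^3 = - (uzz r z + urr r z + ur r z / r)" using pde[OF r, of z] by simp
  finally show "1 - \<kappa> * u r z \<le> - \<kappa> * uzz r z + - \<kappa> * urr r z + - \<kappa> * ur r z / r"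
    by (simp add: m_def algebra_simps)
next
  fix r z :: real assume r: "r > 0"
  show "((\<lambda>r. 1 - \<kappa> * u r z) has_real_derivative - \<kappa> * ur r z) (at r)"
    "((\<lambda>z. 1 - \<kappa> * u r z) has_real_derivative - \<kappa> * uz r z) (at z)"
    using DERIV_diff[OF DERIV_const DERIV_cmult[OF deriv_u_r[OF r]]]
      DERIV_diff[OF DERIV_const DERIV_cmult[OF deriv_u_z[OF r]]] by simp_all
  show "((\<lambda>r. - \<kappa> * ur r z) has_real_derivative - \<kappa> * urr r z) (at r)"
    "((\<lambda>z. - \<kappa> * uz r z) has_real_derivative - \<kappa> * uzz r z) (at z)"
    by (rule DERIV_cmult deriv_ur_r deriv_uz_z r)+
qed

text \<open>The doubling estimate for \<open>u - \<kappa>\<close>; with \<open>r0 \<ge> 2\<close>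
  the unit box stays at radii at least 1, where the drift \<open>1 / r\<close> is at most 1.
  Exchanging the two variables gives the bound for \<open>uz\<close>, and 105 is
  \<open>7 * (2 + 13)\<close>.\<close>

lemma gradient_bound:
  assumes r0: "r0 \<ge> 2" and M: "M > 0"
    and u: "\<And>r z. \<bar>r - r0\<bar> \<le> 1 \<Longrightarrow> \<bar>z - z0\<bar> \<le> 1 \<Longrightarrow> \<bar>u r z - \<kappa>\<bar> \<le> M"
    and f: "\<And>r z. \<bar>r - r0\<bar> \<le> 1 \<Longrightarrow> \<bar>z - z0\<bar> \<le> 1 \<Longrightarrow> \<bar>u r z - (u r z)^3\<bar> \<le> 2 * M"
  shows "\<bar>ur r0 z0\<bar> \<le> 105 * M" "\<bar>uz r0 z0\<bar> \<le> 105 * M"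
proof -
  have c: "continuous_on ({r0-1..r0+1} \<times> {z0-1..z0+1}) (\<lambda>p. u (fst p) (snd p))"
  proof -
    have "{r0-1..r0+1} \<times> {z0-1..z0+1} \<subseteq> {0<..} \<times> UNIV" using r0 by auto
    from continuous_on_subset[OF cont_u this] show ?thesis
      unfolding split_beta .
  qed
  have c': "continuous_on ({z0-1..z0+1} \<times> {r0-1..r0+1}) (\<lambda>p. u (snd p) (fst p))"
    by (rule continuous_on_compose2[OF c, where f = prod.swap, simplified]) (auto intro!: continuous_intros)
  have D: "((\<lambda>r. u r z - \<kappa>) has_real_derivative ur r z) (at r)"
    "((\<lambda>r. ur r z) has_real_derivative urr r z) (at r)"
    "((\<lambda>z. u r z - \<kappa>) has_real_derivative uz r z) (at z)"
    "(uz r has_real_derivative uzz r z) (at z)"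
    "\<bar>1 / r\<bar> \<le> 1"
    if "\<bar>r - r0\<bar> \<le> 1" for r z
  proof -
    have r: "r > 0" "r \<ge> 1" using that r0 by auto
    show "((\<lambda>r. u r z - \<kappa>) has_real_derivative ur r z) (at r)"
      "((\<lambda>z. u r z - \<kappa>) has_real_derivative uz r z) (at z)"
      using DERIV_diff[OF deriv_u_r[OF r(1)] DERIV_const] DERIV_diff[OF deriv_u_z[OF r(1)] DERIV_const]
      by simp_all
  qed (use that r0 in \<open>auto intro!: deriv_ur_r deriv_uz_z\<close>)
  have N: "\<bar>urr r z + 1 / r * ur r z + uzz r z\<bar> \<le> 2 * M"
    if "\<bar>r - r0\<bar> \<le> 1" "\<bar>z - z0\<bar> \<le> 1" for r z
  proof -
    have r: "r > 0" using that r0 by auto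
    have "urr r z + 1 / r * ur r z + uzz r z = - (u r z - (u r z)^3)" using pde[OF r, of z] by simp
    then show ?thesis using f[OF that] by simp
  qed
  have "\<bar>ur r0 z0\<bar> \<le> 7 * (2 * M + 13 * M)"
  proof (rule doubling_gradient_bound_abs[where ?x0.0 = r0 and ?y0.0 = z0 and f = "\<lambda>r z. u r z - \<kappa>"
      and fx = ur and fy = uz and fxx = urr and fyy = uzz and b = "\<lambda>r. 1 / r" and e = "\<lambda>_. 0"])
    show "continuous_on ({r0-1..r0+1} \<times> {z0-1..z0+1}) (\<lambda>(x, y). u x y - \<kappa>)"
      unfolding split_beta by (intro continuous_intros c)
    show "\<bar>urr r z + 1 / r * ur r z + uzz r z + 0 * uz r z\<bar> \<le> 2 * M"
      if "\<bar>r - r0\<bar> \<le> 1" "\<bar>z - z0\<bar> \<le> 1" for r z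
      using N[OF that] by simp
  qed (rule D u M | assumption | simp)+
  moreover have "\<bar>uz r0 z0\<bar> \<le> 7 * (2 * M + 13 * M)"
  proof (rule doubling_gradient_bound_abs[where ?x0.0 = z0 and ?y0.0 = r0 and f = "\<lambda>z r. u r z - \<kappa>"
      and fx = "\<lambda>z r. uz r z" and fy = "\<lambda>z r. ur r z" and fxx = "\<lambda>z r. uzz r z"
      and fyy = "\<lambda>z r. urr r z" and e = "\<lambda>r. 1 / r" and b = "\<lambda>_. 0"])
    show "continuous_on ({z0-1..z0+1} \<times> {r0-1..r0+1}) (\<lambda>(x, y). u y x - \<kappa>)"
      unfolding split_beta by (intro continuous_intros c')
    show "\<bar>uzz r z + 0 * uz r z + urr r z + 1 / r * ur r z\<bar> \<le> 2 * M"
      if "\<bar>z - z0\<bar> \<le> 1" "\<bar>r - r0\<bar> \<le> 1" for z r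
      using N[OF that(2,1)] by (simp add: algebra_simps)
  qed (rule D u M | assumption | simp)+
  ultimately show "\<bar>ur r0 z0\<bar> \<le> 105 * M" "\<bar>uz r0 z0\<bar> \<le> 105 * M" by simp_all
qed


lemma u_abs: "r > 0 \<Longrightarrow> u r \<bar>z\<bar> = u r z"
  using even[of r z] by (simp add: abs_real_def)

text \<open>An error of 1/10 from \<open>H\<close> and one of 1/10 from the convergence stay below
  3/10, the threshold in \<open>decay_from_box\<close>. Evenness passes from
  \<open>z \<ge> 0\<close> to \<open>\<bar>z\<bar>\<close>.\<close>

lemma near_pure_phases:
  obtains A R where "A \<ge> 0" "R \<ge> 1"
    "\<And>r z. r \<ge> R \<Longrightarrow> q r + A \<le> \<bar>z\<bar> \<Longrightarrow> 1 - u r z \<le> 3 / 10"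
    "\<And>r z. r \<ge> R \<Longrightarrow> \<bar>z\<bar> \<le> q r - A \<Longrightarrow> 1 + u r z \<le> 3 / 10"
proof -
  obtain A where A: "A \<ge> 0" "\<And>x. x \<ge> A \<Longrightarrow> 1 - H x \<le> 1/10" "\<And>x. x \<le> - A \<Longrightarrow> 1 + H x \<le> 1/10"
    using H_close_to_1[of "1/10"] by auto
  obtain R where R: "R \<ge> 1" "\<And>r z. r \<ge> R \<Longrightarrow> z \<ge> 0 \<Longrightarrow> \<bar>u r z - H (z - q r)\<bar> \<le> 1/10"
    using asymp_closed[of "1/10"] by auto
  show thesis
  proof (rule that[OF A(1) R(1)])
    fix r z assume r: "r \<ge> R"
    have *: "\<bar>u r z - H (\<bar>z\<bar> - q r)\<bar> \<le> 1/10" using R(2)[OF r, of "\<bar>z\<bar>"] u_abs[of r z] R(1) r by simp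
    show "1 - u r z \<le> 3 / 10" if "q r + A \<le> \<bar>z\<bar>"
      using A(2)[of "\<bar>z\<bar> - q r"] that * by linarith
    show "1 + u r z \<le> 3 / 10" if "\<bar>z\<bar> \<le> q r - A"
      using A(3)[of "\<bar>z\<bar> - q r"] that * by linarith
  qed
qed

text \<open>The box has half-side \<open>d\<close> equal to half the distance from
  \<open>\<bar>z\<bar>\<close> to the layer of width \<open>A\<close> around the interface. Over it
  \<open>q\<close> moves by at most \<open>d\<close>, so the box stays in the pure phase, and the
  rate 1/2 in \<open>d\<close> becomes 1/4 in the distance. The restriction
  \<open>\<bar>z\<bar> \<le> 3 / 2 * r\<close> gives \<open>d \<le> 3 / 4 * r\<close>, which keeps
  the box at radii at least \<open>r / 4\<close>.\<close>

lemma profile_decay: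
  obtains A R where "A \<ge> 0" "R \<ge> 1" "\<And>r. r \<ge> R \<Longrightarrow> 0 \<le> q r \<and> q r \<le> r / 32"
    "\<And>r z. r \<ge> R \<Longrightarrow> \<bar>z\<bar> \<le> 3 / 2 * r \<Longrightarrow> q r + A \<le> \<bar>z\<bar> \<Longrightarrow> 1 - u r z \<le> 4 * exp (- (\<bar>z\<bar> - q r - A) / 4)"
    "\<And>r z. r \<ge> R \<Longrightarrow> \<bar>z\<bar> \<le> q r - A \<Longrightarrow> 1 + u r z \<le> 4 * exp (- (q r - A - \<bar>z\<bar>) / 4)"
proof -
  obtain A R0 where A: "A \<ge> 0" and R0: "R0 \<ge> 1"
    and up: "\<And>r z. r \<ge> R0 \<Longrightarrow> q r + A \<le> \<bar>z\<bar> \<Longrightarrow> 1 - u r z \<le> 3 / 10"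
    and low: "\<And>r z. r \<ge> R0 \<Longrightarrow> \<bar>z\<bar> \<le> q r - A \<Longrightarrow> 1 + u r z \<le> 3 / 10"
    using near_pure_phases by blast
  obtain R1 where R1: "R1 \<ge> 1" "\<And>r. r \<ge> R1 \<Longrightarrow> 0 \<le> q r" "\<And>r. r \<ge> R1 \<Longrightarrow> q r \<le> r / 32"
    using eventually_q[of 0] by blast
  show thesis
  proof (rule that[of A "max (4 * R0) R1"])
    fix r z assume r: "r \<ge> max (4 * R0) R1"
    then have r': "r \<ge> 4 * R0" "0 \<le> q r" "q r \<le> r / 32" using R1 by auto
    have r0: "r \<ge> 4" using r' R0 by simp
    have u1: "\<bar>u r z\<bar> < 1" using bounded[of r z] r0 by simp
    show "1 - u r z \<le> 4 * exp (- (\<bar>z\<bar> - q r - A) / 4)" if z: "\<bar>z\<bar> \<le> 3 / 2 * r" "q r + A \<le> \<bar>z\<bar>"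
    proof (cases "q r + A = \<bar>z\<bar>")
      case True
      then have "\<bar>z\<bar> - q r - A = 0" by simp
      then show ?thesis using u1 by simp
    next
      case False
      define d where "d = (\<bar>z\<bar> - q r - A) / 2"
      have dd: "- d / 2 = - (\<bar>z\<bar> - q r - A) / 4" by (simp add: d_def field_simps)
      have d: "d > 0" "d \<le> 3 / 4 * r" using False z A r' by (auto simp: d_def)
      have rd: "r - d \<ge> R0" using d r' by simp
      have "1 - 1 * u r z \<le> 4 * exp (- d / 2)"
      proof (rule decay_from_box)
        fix s y assume sy: "\<bar>s - r\<bar> \<le> d" "\<bar>y - z\<bar> \<le> d"
        have s: "s \<ge> R0" "s > 0" using sy rd R0 by auto
        have "q s - q r \<le> \<bar>s - r\<bar> / r" using q_diff_le[of r s] s r0 by simp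
        also have "\<dots> \<le> \<bar>s - r\<bar> / 1" using r0 by (intro divide_left_mono) auto
        also have "\<dots> \<le> d" using sy by simp
        finally have "q s \<le> q r + d" by simp
        moreover have "\<bar>y\<bar> \<ge> \<bar>z\<bar> - d" using sy(2) by linarith
        moreover have "\<bar>z\<bar> = q r + A + 2 * d" by (simp add: d_def field_simps)
        ultimately have "q s + A \<le> \<bar>y\<bar>" by linarith
        from up[OF s(1) this] show "1 - 1 * u s y \<le> 3 / 10" by simp
      qed (use d rd R0 in auto)
      then show ?thesis unfolding dd by simp
    qed
    show "1 + u r z \<le> 4 * exp (- (q r - A - \<bar>z\<bar>) / 4)" if z: "\<bar>z\<bar> \<le> q r - A"
    proof (cases "\<bar>z\<bar> = q r - A")
      case True
      then show ?thesis using u1 by simp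
    next
      case False
      define d where "d = (q r - A - \<bar>z\<bar>) / 2"
      have dd: "- d / 2 = - (q r - A - \<bar>z\<bar>) / 4" by (simp add: d_def field_simps)
      have d: "d > 0" "d \<le> r / 4" using False z A r' by (auto simp: d_def)
      have rd: "r - d \<ge> R0" using d r' R0 by simp
      have "1 - (-1) * u r z \<le> 4 * exp (- d / 2)"
      proof (rule decay_from_box)
        fix s y assume sy: "\<bar>s - r\<bar> \<le> d" "\<bar>y - z\<bar> \<le> d"
        have s: "s \<ge> R0" "s \<ge> 1" using sy rd R0 by auto
        have "q r - q s \<le> \<bar>r - s\<bar> / s" using q_diff_le[of s r] s r0 by simp
        also have "\<dots> \<le> \<bar>r - s\<bar> / 1" using s by (intro divide_left_mono) auto
        also have "\<dots> \<le> d" using sy by simp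
        finally have "q s \<ge> q r - d" by simp
        moreover have "\<bar>y\<bar> \<le> \<bar>z\<bar> + d" using sy(2) by linarith
        moreover have "\<bar>z\<bar> = q r - A - 2 * d" by (simp add: d_def field_simps)
        ultimately have "\<bar>y\<bar> \<le> q s - A" by linarith
        from low[OF s(1) this] show "1 - (-1) * u s y \<le> 3 / 10" by simp
      qed (use d rd R0 in auto)
      then show ?thesis unfolding dd by simp
    qed
    show "0 \<le> q r \<and> q r \<le> r / 32" using r' by simp
  qed (use A R0 in auto)
qed

text \<open>Away from the interface, \<open>profile_decay\<close> on the unit box feeds
  \<open>gradient_bound\<close>; the 2 in \<open>A + 2\<close> pays for changes of at most 1 in
  \<open>\<bar>z\<bar>\<close> and in \<open>q\<close>. Close to the interface \<open>E\<close> is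
  at least 1 and uniform bounds suffice. The constant 420 is \<open>105 * 4\<close>.\<close>

lemma profile_exp_bounds:
  obtains C R where "C > 0" "R \<ge> 5" "\<And>r. r \<ge> R \<Longrightarrow> 0 \<le> q r \<and> q r \<le> r / 32"
    "\<And>r z. r \<ge> R \<Longrightarrow> \<bar>z\<bar> \<le> r \<Longrightarrow> 1 - (u r z)^2 \<le> C * exp (- \<bar>\<bar>z\<bar> - q r\<bar> / 4)"
    "\<And>r z. r \<ge> R \<Longrightarrow> \<bar>z\<bar> \<le> r \<Longrightarrow> \<bar>ur r z\<bar> \<le> C * exp (- \<bar>\<bar>z\<bar> - q r\<bar> / 4)"
    "\<And>r z. r \<ge> R \<Longrightarrow> \<bar>z\<bar> \<le> r \<Longrightarrow> \<bar>uz r z\<bar> \<le> C * exp (- \<bar>\<bar>z\<bar> - q r\<bar> / 4)"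
proof -
  obtain A R where A: "A \<ge> 0" and R: "R \<ge> 1" and qR: "\<And>r. r \<ge> R \<Longrightarrow> 0 \<le> q r \<and> q r \<le> r / 32"
    and up: "\<And>r z. r \<ge> R \<Longrightarrow> \<bar>z\<bar> \<le> 3 / 2 * r \<Longrightarrow> q r + A \<le> \<bar>z\<bar> \<Longrightarrow> 1 - u r z \<le> 4 * exp (- (\<bar>z\<bar> - q r - A) / 4)"
    and low: "\<And>r z. r \<ge> R \<Longrightarrow> \<bar>z\<bar> \<le> q r - A \<Longrightarrow> 1 + u r z \<le> 4 * exp (- (q r - A - \<bar>z\<bar>) / 4)"
    using profile_decay by blast
  define E where "E r z = exp (- (\<bar>\<bar>z\<bar> - q r\<bar> - A - 2) / 4)" for r z
  have E_eq: "E r z = exp ((A + 2) / 4) * exp (- \<bar>\<bar>z\<bar> - q r\<bar> / 4)" for r z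
    unfolding E_def exp_add[symmetric] by (simp add: field_simps)
  have main: "1 - (u r z)^2 \<le> 420 * E r z \<and> \<bar>ur r z\<bar> \<le> 420 * E r z \<and> \<bar>uz r z\<bar> \<le> 420 * E r z"
    if r: "r \<ge> max (R + 1) 5" and z: "\<bar>z\<bar> \<le> r" for r z
  proof -
    have E0: "E r z > 0" by (simp add: E_def)
    have r0: "r > 0" "r \<ge> 2" using r by auto
    have qs: "\<bar>q s - q r\<bar> \<le> 1" "s \<ge> R" "s > 0" "\<bar>y\<bar> \<le> 3 / 2 * s"
      if "\<bar>s - r\<bar> \<le> 1" "\<bar>y - z\<bar> \<le> 1" for s y
    proof -
      show s: "s \<ge> R" "s > 0" using that r R by auto
      have "\<bar>s - r\<bar> / r \<le> 1" "\<bar>r - s\<bar> / s \<le> 1"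
        using that s r by (auto simp: divide_le_eq)
      then show "\<bar>q s - q r\<bar> \<le> 1" using q_diff_le[of r s] q_diff_le[of s r] s r0 by linarith
      have "\<bar>y\<bar> \<le> r + 1" "s \<ge> r - 1" using that z by linarith+
      then show "\<bar>y\<bar> \<le> 3 / 2 * s" using r by simp
    qed
    have u1: "\<bar>u s y\<bar> < 1" if "s > 0" for s y using bounded that by simp
    have fac1: "1 - (u r z)^2 \<le> 2 * (1 - u r z)" "1 - (u r z)^2 \<le> 2 * (1 + u r z)"
      using u1[OF r0(1), of z] zero_le_power2[of "1 - u r z"] zero_le_power2[of "1 + u r z"]
      by (simp_all add: power2_eq_square algebra_simps)
    consider "\<bar>z\<bar> \<ge> q r + A + 2" | "\<bar>z\<bar> \<le> q r - A - 2" | "\<bar>\<bar>z\<bar> - q r\<bar> < A + 2" by linarith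
    then show ?thesis
    proof cases
      case 1
      have E': "E r z = exp (- (\<bar>z\<bar> - q r - A - 2) / 4)" using 1 A by (simp add: E_def)
      have b: "1 - u s y \<le> 4 * E r z" if "\<bar>s - r\<bar> \<le> 1" "\<bar>y - z\<bar> \<le> 1" for s y
      proof -
        have y: "\<bar>y\<bar> \<ge> \<bar>z\<bar> - 1" using that by linarith
        have "1 - u s y \<le> 4 * exp (- (\<bar>y\<bar> - q s - A) / 4)"
          by (rule up) (use qs[OF that] y 1 in auto)
        also have "\<dots> \<le> 4 * E r z" unfolding E' using qs(1)[OF that] y by auto
        finally show ?thesis .
      qed
      have "\<bar>ur r z\<bar> \<le> 105 * (4 * E r z)" "\<bar>uz r z\<bar> \<le> 105 * (4 * E r z)"
      proof (rule_tac [1-2] gradient_bound[where \<kappa> = 1])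
        fix s y assume sy: "\<bar>s - r\<bar> \<le> 1" "\<bar>y - z\<bar> \<le> 1"
        show 1: "\<bar>u s y - 1\<bar> \<le> 4 * E r z" using b[OF sy] u1[OF qs(3)[OF sy], of y] by simp
        show "\<bar>u s y - u s y ^ 3\<bar> \<le> 2 * (4 * E r z)"
          using 1 abs_nonlinearity_le(1)[OF qs(3)[OF sy], of y] by simp
        then show "\<bar>u s y - u s y ^ 3\<bar> \<le> 2 * (4 * E r z)" .
        show "\<bar>u s y - 1\<bar> \<le> 4 * E r z" by fact
      qed (use r0 E0 in auto)
      then show ?thesis using fac1(1) b[of r z] E0 by simp
    next
      case 2
      have E': "E r z = exp (- (q r - A - 2 - \<bar>z\<bar>) / 4)" using 2 A by (simp add: E_def)
      have b: "1 + u s y \<le> 4 * E r z" if "\<bar>s - r\<bar> \<le> 1" "\<bar>y - z\<bar> \<le> 1" for s y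
      proof -
        have y: "\<bar>y\<bar> \<le> \<bar>z\<bar> + 1" using that by linarith
        have "1 + u s y \<le> 4 * exp (- (q s - A - \<bar>y\<bar>) / 4)"
          by (rule low) (use qs[OF that] y 2 in auto)
        also have "\<dots> \<le> 4 * E r z" unfolding E' using qs(1)[OF that] y by auto
        finally show ?thesis .
      qed
      have "\<bar>ur r z\<bar> \<le> 105 * (4 * E r z)" "\<bar>uz r z\<bar> \<le> 105 * (4 * E r z)"
      proof (rule_tac [1-2] gradient_bound[where \<kappa> = "-1"])
        fix s y assume sy: "\<bar>s - r\<bar> \<le> 1" "\<bar>y - z\<bar> \<le> 1"
        show 1: "\<bar>u s y - (-1)\<bar> \<le> 4 * E r z" using b[OF sy] u1[OF qs(3)[OF sy], of y] by simp
        show "\<bar>u s y - u s y ^ 3\<bar> \<le> 2 * (4 * E r z)"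
          using 1 abs_nonlinearity_le(2)[OF qs(3)[OF sy], of y] by simp
        then show "\<bar>u s y - u s y ^ 3\<bar> \<le> 2 * (4 * E r z)" .
        show "\<bar>u s y - (-1)\<bar> \<le> 4 * E r z" by fact
      qed (use r0 E0 in auto)
      then show ?thesis using fac1(2) b[of r z] E0 by simp
    next
      case 3
      then have E1: "E r z \<ge> 1" by (simp add: E_def)
      have "\<bar>ur r z\<bar> \<le> 105 * 1" "\<bar>uz r z\<bar> \<le> 105 * 1"
      proof (rule_tac [1-2] gradient_bound[where \<kappa> = 0])
        fix s y assume sy: "\<bar>s - r\<bar> \<le> 1" "\<bar>y - z\<bar> \<le> 1"
        show 1: "\<bar>u s y - 0\<bar> \<le> 1" using u1[OF qs(3)[OF sy], of y] by simp
        show "\<bar>u s y - u s y ^ 3\<bar> \<le> 2 * 1"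
          using abs_nonlinearity_le(3)[OF qs(3)[OF sy], of y] by simp
        then show "\<bar>u s y - u s y ^ 3\<bar> \<le> 2 * 1" .
        show "\<bar>u s y - 0\<bar> \<le> 1" by fact
      qed (use r0 in auto)
      moreover have "1 - (u r z)^2 \<le> 1" by simp
      ultimately show ?thesis using E1 by linarith
    qed
  qed
  show thesis
  proof (rule that[of "420 * exp ((A + 2) / 4)" "max (R + 1) 5"])
    fix r z :: real assume rz: "max (R + 1) 5 \<le> r" "\<bar>z\<bar> \<le> r"
    note m = main[OF rz, unfolded E_eq]
    show "1 - (u r z)^2 \<le> 420 * exp ((A + 2) / 4) * exp (- \<bar>\<bar>z\<bar> - q r\<bar> / 4)"
      "\<bar>ur r z\<bar> \<le> 420 * exp ((A + 2) / 4) * exp (- \<bar>\<bar>z\<bar> - q r\<bar> / 4)"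
      "\<bar>uz r z\<bar> \<le> 420 * exp ((A + 2) / 4) * exp (- \<bar>\<bar>z\<bar> - q r\<bar> / 4)"
      using m by (simp_all add: mult.assoc)
  qed (use qR in auto)
qed

text \<open>The exponential is weakened by \<open>exp (x / 4) \<ge> 1 + x^2 / 32\<close> for
  \<open>x \<ge> 0\<close>, since \<open>1 / (1 + x^2)\<close> has the antiderivative
  \<open>arctan\<close> and hence an integral bounded independently of the centre
  \<open>q r\<close>.\<close>

lemma profile_bounds:
  obtains C R where "C > 0" "R \<ge> 5" "\<And>r. r \<ge> R \<Longrightarrow> 0 \<le> q r \<and> q r \<le> r / 32"
    "\<And>r z. r \<ge> R \<Longrightarrow> 0 \<le> z \<Longrightarrow> z \<le> r \<Longrightarrow> 1 - (u r z)^2 \<le> C / (1 + (z - q r)^2)"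
    "\<And>r z. r \<ge> R \<Longrightarrow> 0 \<le> z \<Longrightarrow> z \<le> r \<Longrightarrow> \<bar>ur r z\<bar> \<le> C / (1 + (z - q r)^2)"
    "\<And>r z. r \<ge> R \<Longrightarrow> 0 \<le> z \<Longrightarrow> z \<le> r \<Longrightarrow> \<bar>uz r z\<bar> \<le> C / (1 + (z - q r)^2)"
proof -
  obtain C R where C: "C > 0" and R: "R \<ge> 5" and qR: "\<And>r. r \<ge> R \<Longrightarrow> 0 \<le> q r \<and> q r \<le> r / 32"
    and b: "\<And>r z. r \<ge> R \<Longrightarrow> \<bar>z\<bar> \<le> r \<Longrightarrow> 1 - (u r z)^2 \<le> C * exp (- \<bar>\<bar>z\<bar> - q r\<bar> / 4)"
    "\<And>r z. r \<ge> R \<Longrightarrow> \<bar>z\<bar> \<le> r \<Longrightarrow> \<bar>ur r z\<bar> \<le> C * exp (- \<bar>\<bar>z\<bar> - q r\<bar> / 4)"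
    "\<And>r z. r \<ge> R \<Longrightarrow> \<bar>z\<bar> \<le> r \<Longrightarrow> \<bar>uz r z\<bar> \<le> C * exp (- \<bar>\<bar>z\<bar> - q r\<bar> / 4)"
    using profile_exp_bounds by blast
  have e: "C * exp (- \<bar>\<bar>z\<bar> - q r\<bar> / 4) \<le> (32 * C) / (1 + (z - q r)^2)" if "z \<ge> 0" for r z
  proof -
    define x where "x = z - q r"
    have "1 + \<bar>x\<bar> / 4 + (\<bar>x\<bar> / 4)^2 / 2 \<le> exp (\<bar>x\<bar> / 4)" by (rule exp_lower_Taylor_quadratic) simp
    then have "1 + x^2 / 32 \<le> exp (\<bar>x\<bar> / 4)" by (simp add: power_divide)
    then have "1 + x^2 \<le> 32 * exp (\<bar>x\<bar> / 4)" by simp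
    then have "exp (- (\<bar>x\<bar> / 4)) * (1 + x^2) \<le> exp (- (\<bar>x\<bar> / 4)) * (32 * exp (\<bar>x\<bar> / 4))"
      by (intro mult_left_mono) auto
    also have "\<dots> = 32" by (simp add: exp_minus)
    finally have "exp (- (\<bar>x\<bar> / 4)) \<le> 32 / (1 + x^2)"
      by (simp add: pos_le_divide_eq add_pos_nonneg)
    from mult_left_mono[OF this, of C] C show ?thesis using that by (simp add: x_def mult.commute)
  qed
  show thesis
  proof (rule that[of "32 * C" R])
    fix r z assume rz: "r \<ge> R" "0 \<le> z" "z \<le> r"
    then have z: "\<bar>z\<bar> \<le> r" by simp
    show "1 - (u r z)^2 \<le> 32 * C / (1 + (z - q r)^2)" "\<bar>ur r z\<bar> \<le> 32 * C / (1 + (z - q r)^2)"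
      "\<bar>uz r z\<bar> \<le> 32 * C / (1 + (z - q r)^2)"
      using b[OF rz(1) z] e[OF rz(2), of r] by linarith+
  qed (use C R qR in auto)
qed

end

section \<open>Lower bound on the axis of symmetry\<close>

context two_end_profile
begin

lemma axis_lower_bound:
  obtains c0 R where "c0 > 0" "R \<ge> 1" "\<And>r. r \<ge> R \<Longrightarrow> 1 + u r 0 \<ge> c0 / r"
proof -
  \<comment> \<open>\<open>v = 1 + u\<close> satisfies \<open>\<Delta>v \<le> 2 * v\<close>, and the comparison function has rate exactly \<open>sqrt 2\<close> in \<open>z\<close>,
    which is what makes \<open>k = sqrt 2 / 2\<close> admissible.\<close>
  obtain A R0 where A: "A \<ge> 0" and R0: "R0 \<ge> 1"
    and up: "\<And>r z. r \<ge> R0 \<Longrightarrow> q r + A \<le> \<bar>z\<bar> \<Longrightarrow> 1 - u r z \<le> 3 / 10"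
    and "\<And>r z. r \<ge> R0 \<Longrightarrow> \<bar>z\<bar> \<le> q r - A \<Longrightarrow> 1 + u r z \<le> 3 / 10"
    using near_pure_phases by blast
  obtain R1 where R1: "R1 \<ge> 1" "\<And>r. r \<ge> R1 \<Longrightarrow> 1 \<le> q r" "\<And>r. r \<ge> R1 \<Longrightarrow> q r \<le> r / 32"
    using eventually_q[of 1] by blast
  define c0 where "c0 = exp (- sqrt 2 * (k * ln 2 - c + A)) / 4"
  show thesis
  proof (rule that[of c0 "max (2 * R0) (max R1 (max 8 (16 * A)))"])
    fix r assume "r \<ge> max (2 * R0) (max R1 (max 8 (16 * A)))"
    then have r: "r \<ge> 2 * R0" "r \<ge> R1" "r \<ge> 8" "r \<ge> 16 * A" by auto
    \<comment> \<open>This height lies at least \<open>A\<close> above the interface at every radius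
      in \<open>[r / 2, 3 / 2 * r]\<close>, so \<open>u \<ge> 7 / 10\<close> on the sides
      \<open>z = h\<close> and \<open>z = - h\<close>.\<close>
    define h where "h = q (2 * r) + A"
    have h: "h \<ge> 1" "h \<le> r / 8" using R1(2)[of "2 * r"] R1(3)[of "2 * r"] r A by (auto simp: h_def)
    \<comment> \<open>Both terms are normalised to equal 1/2 at the boundary: the \<alpha> term on
      \<open>z = h\<close> and \<open>z = - h\<close>, below \<open>1 + u\<close> there, and the
      \<open>B\<close> term on the lateral sides, where it cancels the \<alpha> term.\<close>
    define \<alpha> where "\<alpha> = 1 / (2 * cosh (sqrt 2 * h))"
    define B where "B = 1 / (2 * cosh (r / 2))"
    have ab: "\<alpha> > 0" "B > 0" by (simp_all add: \<alpha>_def B_def cosh_real_pos)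
    define g where "g s z = \<alpha> * cosh (sqrt 2 * z) - B * cosh (s - r) - (1 + u s z)" for s z
    define gr where "gr s z = - B * sinh (s - r) - ur s z" for s z
    define gz where "gz s z = \<alpha> * (sqrt 2 * sinh (sqrt 2 * z)) - uz s z" for s z
    define grr where "grr s z = - B * cosh (s - r) - urr s z" for s z
    define gzz where "gzz s z = \<alpha> * (2 * cosh (sqrt 2 * z)) - uzz s z" for s z
    have "g r 0 \<le> 0"
    proof (rule maximum_principle_rectangle[where g = g and gx = gr and gy = gz and gxx = grr and gyy = gzz
          and a = "r / 2" and b = "3 / 2 * r" and c = "- h" and d = h])
      have sub: "{r / 2..3 / 2 * r} \<times> {- h..h} \<subseteq> {0<..} \<times> UNIV" using r by auto
      show "continuous_on ({r / 2..3 / 2 * r} \<times> {- h..h}) (\<lambda>(x, y). g x y)"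
        using continuous_on_subset[OF cont_u sub] unfolding g_def split_beta
        by (intro continuous_intros)
      fix s z assume sz: "r / 2 < s" "s < 3 / 2 * r" "- h < z" "z < h"
      then have s: "s > 0" "s \<ge> 1" using r by auto
      show "((\<lambda>x. g x z) has_real_derivative gr s z) (at s)"
        unfolding g_def gr_def
        by (rule derivative_eq_intros deriv_u_r[OF s(1)] refl | simp)+
      show "((\<lambda>x. gr x z) has_real_derivative grr s z) (at s)"
        unfolding gr_def grr_def
        by (rule derivative_eq_intros deriv_ur_r[OF s(1)] refl | simp)+
      show "(g s has_real_derivative gz s z) (at z)"
        unfolding g_def gz_def
        by (rule derivative_eq_intros deriv_u_z[OF s(1)] refl | simp)+
      show "(gz s has_real_derivative gzz s z) (at z)"
        unfolding gz_def gzz_def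
        by (rule derivative_eq_intros deriv_uz_z[OF s(1)] refl | simp)+
      assume pos: "g s z > 0" and crit: "gr s z = 0" "gz s z = 0" "grr s z \<le> 0" "gzz s z \<le> 0"
      define v where "v = 1 + u s z"
      have v: "0 < v" "v < 2" using bounded[OF s(1), of z] by (auto simp: v_def)
      have "u s z - u s z ^ 3 = - (2 * v) + v^2 * (3 - v)"
        by (simp add: v_def algebra_simps power2_eq_square power3_eq_cube)
      moreover have "v^2 * (3 - v) \<ge> 0" using v by (intro mult_nonneg_nonneg) auto
      ultimately have L: "uzz s z + urr s z + ur s z / s \<le> 2 * v" using pde[OF s(1), of z] by linarith
      have "- ur s z / s = B * sinh (s - r) / s" using crit(1) by (simp add: gr_def minus_equation_iff)
      also have "\<dots> \<le> B * cosh (s - r) / s" using ab s by (intro divide_right_mono mult_left_mono sinh_le_cosh_real) auto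
      also have "\<dots> \<le> B * cosh (s - r) / 1" using ab s by (intro divide_left_mono mult_nonneg_nonneg) auto
      finally have "- ur s z / s \<le> B * cosh (s - r)" by simp
      then have "ur s z / s \<ge> - (B * cosh (s - r))" by simp
      moreover have "urr s z \<ge> - (B * cosh (s - r))" "uzz s z \<ge> 2 * (\<alpha> * cosh (sqrt 2 * z))"
        using crit by (auto simp: grr_def gzz_def)
      ultimately have "2 * v \<ge> 2 * (\<alpha> * cosh (sqrt 2 * z)) - 2 * (B * cosh (s - r))" using L by linarith
      then show False using pos by (simp add: g_def v_def)
    next
      fix s z assume sz: "r / 2 \<le> s" "s \<le> 3 / 2 * r" "- h \<le> z" "z \<le> h"
        "s = r / 2 \<or> s = 3 / 2 * r \<or> z = - h \<or> z = h"
      then have s: "s > 0" "s \<ge> R0" using r by auto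
      have v: "1 + u s z > 0" using bounded[OF s(1), of z] by linarith
      have ch: "\<alpha> * cosh (sqrt 2 * z) \<le> 1 / 2"
      proof -
        have "cosh (sqrt 2 * z) \<le> cosh (sqrt 2 * h)"
          using sz h by (subst cosh_real_abs[symmetric]) (auto simp: abs_mult intro!: cosh_real_nonneg_le_iff[THEN iffD2])
        then have "\<alpha> * cosh (sqrt 2 * z) \<le> \<alpha> * cosh (sqrt 2 * h)" using ab by simp
        also have "\<dots> = 1 / 2" by (simp add: \<alpha>_def)
        finally show ?thesis .
      qed
      have Bc: "B * cosh (s - r) > 0" using ab by (simp add: cosh_real_pos)
      show "g s z \<le> 0"
      proof (cases "z = - h \<or> z = h")
        case True
        have "k * ln s \<le> k * ln (2 * r)" using k s sz by (intro mult_left_mono) auto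
        then have "q s \<le> q (2 * r)" by (simp add: q_def)
        then have "1 - u s z \<le> 3 / 10" using True h by (intro up s) (auto simp: h_def)
        then show ?thesis using ch Bc by (simp add: g_def)
      next
        case False
        then have "s - r = r / 2 \<or> s - r = - (r / 2)" using sz by auto
        then have "cosh (s - r) = cosh (r / 2)" by (elim disjE) (simp_all only: cosh_minus)
        then have "B * cosh (s - r) = 1 / 2" by (simp add: B_def)
        then show ?thesis using ch v by (simp add: g_def)
      qed
    qed (use r h in auto)
    then have v0: "1 + u r 0 \<ge> \<alpha> - B" by (simp add: g_def)
    have s2: "sqrt 2 * h \<le> r / 4"
    proof -
      have "sqrt 2 * h \<le> 2 * h" using h real_less_lsqrt[of 2 2] by (intro mult_right_mono) auto
      then show ?thesis using h by linarith
    qed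
    have ch2: "cosh (sqrt 2 * h) \<le> exp (sqrt 2 * h)"
      using h by (simp add: cosh_def)
    \<comment> \<open>The lateral correction is negligible at the centre because
      \<open>sqrt 2 * h \<le> r / 4\<close>, well below \<open>r / 2\<close>.\<close>
    have "B \<le> \<alpha> / 2"
    proof -
      have "4 * cosh (sqrt 2 * h) \<le> 4 * exp (sqrt 2 * h)" using ch2 by simp
      also have "\<dots> \<le> exp 2 * exp (sqrt 2 * h)"
      proof (rule mult_right_mono)
        have "1 + 2 + 2^2 / 2 \<le> exp (2::real)" by (rule exp_lower_Taylor_quadratic) simp
        then show "4 \<le> exp (2::real)" by simp
      qed simp
      also have "\<dots> = exp (2 + sqrt 2 * h)" by (simp add: exp_add)
      also have "\<dots> \<le> exp (r / 2)" using s2 r by simp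
      also have "\<dots> \<le> 2 * cosh (r / 2)" by (simp add: cosh_def)
      finally have "4 * cosh (sqrt 2 * h) \<le> 2 * cosh (r / 2)" .
      then show ?thesis by (simp add: B_def \<alpha>_def cosh_real_pos frac_le)
    qed
    then have "1 + u r 0 \<ge> \<alpha> / 2" using v0 by simp
    moreover have "\<alpha> / 2 \<ge> exp (- (sqrt 2 * h)) / 4"
      using ch2 by (simp add: \<alpha>_def exp_minus inverse_eq_divide frac_le cosh_real_pos)
    moreover have "exp (- (sqrt 2 * h)) / 4 \<ge> c0 / r"
    proof -
      have "- (sqrt 2 * h) = - sqrt 2 * (k * ln 2 - c + A) + - (sqrt 2 * k * ln r)"
        using r by (simp add: h_def q_def ln_mult algebra_simps)
      then have "exp (- (sqrt 2 * h)) / 4 = c0 * exp (- (sqrt 2 * k * ln r))"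
        by (simp only: exp_add c0_def)
      \<comment> \<open>The bound \<open>k \<le> sqrt 2 / 2\<close> enters here: it turns the rate
        \<open>r powr (- (sqrt 2 * k))\<close> into \<open>1 / r\<close>.\<close>
      also have "\<dots> \<ge> c0 * exp (- ln r)"
      proof -
        have "sqrt 2 * k \<le> sqrt 2 * (sqrt 2 / 2)" using k by (intro mult_left_mono) auto
        then have "sqrt 2 * k * ln r \<le> 1 * ln r" using r by (intro mult_right_mono) auto
        then show ?thesis by (simp add: c0_def)
      qed
      finally show ?thesis using r by (simp add: exp_minus inverse_eq_divide)
    qed
    ultimately show "1 + u r 0 \<ge> c0 / r" by linarith
  qed (use R0 in \<open>auto simp: c0_def\<close>)
qed

end

section \<open>Convergence of the vertical derivative\<close>

context two_end_profile
begin

text \<open>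
  Since \<open>ln r\<close> is harmonic in the plane, \<open>H (z - q r)\<close> solves the equation up to \<open>(k / r)\<^sup>2 * H''\<close>, so the
  gradient estimate applies to \<open>u - H (z - q r)\<close>.
\<close>

lemma uz_close_to_H_deriv:
  assumes \<delta>: "\<delta> > 0"
  obtains R where "R \<ge> 5" "\<And>r z. r \<ge> R \<Longrightarrow> z \<ge> 2 \<Longrightarrow> \<bar>uz r z - (1 - (H (z - q r))^2) / sqrt 2\<bar> \<le> 112 * \<delta>"
proof -
  obtain R0 where R0: "R0 \<ge> 1" and close: "\<And>r z. r \<ge> R0 \<Longrightarrow> z \<ge> 0 \<Longrightarrow> \<bar>u r z - H (z - q r)\<bar> \<le> \<delta>"
    using asymp_closed[OF \<delta>] by blast
  show thesis
  proof (rule that[of "max (R0 + 1) (max 5 (1 / \<delta> + 1))"])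
    fix r z :: real assume r': "r \<ge> max (R0 + 1) (max 5 (1 / \<delta> + 1))" and z: "z \<ge> 2"
    then have r: "r \<ge> R0 + 1" "r \<ge> 5" "r \<ge> 1 / \<delta> + 1" by auto
    have pos: "s > 0" "s \<ge> 1" if "\<bar>s - r\<bar> \<le> 1" for s using that r by auto
    define g where "g y s = u s y - H (y - q s)" for y s
    define H1 where "H1 x = (1 - (H x)^2) / sqrt 2" for x
    define H2 where "H2 x = (H x)^3 - H x" for x
    have dH: "(H has_real_derivative H1 x) (at x)" "(H1 has_real_derivative H2 x) (at x)" for x
      using H_deriv H_deriv2 by (auto simp: H1_def[abs_def] H2_def)
    have dq: "((\<lambda>s. y - q s) has_real_derivative - (k / s)) (at s)" if "s > 0" for y s
      unfolding q_def using that by (auto intro!: derivative_eq_intros)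
    have dz: "((\<lambda>y. y - q s) has_real_derivative 1) (at y)" for y s
      by (auto intro!: derivative_eq_intros)
    \<comment> \<open>The first variable is \<open>z\<close> and the second the radius, so the drift
      \<open>1 / s\<close> is carried by \<open>e\<close>. The residual is at most
      \<open>3 * \<delta>\<close>: twice \<delta> from the difference of the nonlinearities and once
      from \<open>(k / s)^2 * (h - h^3)\<close>; hence \<open>112 = 7 * (3 + 13)\<close>.\<close>
    have "\<bar>uz r z - H1 (z - q r)\<bar> \<le> 7 * (3 * \<delta> + 13 * \<delta>)"
    proof (rule doubling_gradient_bound_abs[where ?x0.0 = z and ?y0.0 = r and f = g
        and fx = "\<lambda>y s. uz s y - H1 (y - q s)" and fxx = "\<lambda>y s. uzz s y - H2 (y - q s)"
        and fy = "\<lambda>y s. ur s y - H1 (y - q s) * - (k / s)"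
        and fyy = "\<lambda>y s. urr s y - (H2 (y - q s) * - (k / s) * - (k / s) + H1 (y - q s) * (k / s^2))"
        and b = "\<lambda>_. 0" and e = "\<lambda>s. 1 / s"])
      have "{r-1..r+1} \<times> UNIV \<subseteq> {0<..} \<times> (UNIV :: real set)" using r by auto
      from continuous_on_subset[OF cont_u this]
      have c1: "continuous_on ({z-1..z+1} \<times> {r-1..r+1}) (\<lambda>p. (\<lambda>(r, z). u r z) (prod.swap p))"
        by (rule continuous_on_compose2) (auto intro!: continuous_intros)
      have c2: "continuous_on ({z-1..z+1} \<times> {r-1..r+1}) (\<lambda>p. H (fst p - q (snd p)))"
        unfolding q_def using r
        by (intro continuous_on_compose2[OF continuous_H[of UNIV]] continuous_intros) auto
      show "continuous_on ({z-1..z+1} \<times> {r-1..r+1}) (\<lambda>(x, y). g x y)"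
        using continuous_on_diff[OF c1 c2] by (simp add: g_def split_beta)
      fix y s assume ys: "\<bar>y - z\<bar> \<le> 1" "\<bar>s - r\<bar> \<le> 1"
      have s: "s > 0" "s \<ge> 1" "s \<ge> R0" "y \<ge> 0" using pos ys r z by auto
      show "((\<lambda>y. g y s) has_real_derivative uz s y - H1 (y - q s)) (at y)"
        unfolding g_def
        using DERIV_diff[OF deriv_u_z[OF s(1)] DERIV_chain2[OF dH(1) dz]] by simp
      show "((\<lambda>y. uz s y - H1 (y - q s)) has_real_derivative uzz s y - H2 (y - q s)) (at y)"
        using DERIV_diff[OF deriv_uz_z[OF s(1)] DERIV_chain2[OF dH(2) dz]] by simp
      show "(g y has_real_derivative ur s y - H1 (y - q s) * - (k / s)) (at s)"
        unfolding g_def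
        by (rule DERIV_diff[OF deriv_u_r[OF s(1)] DERIV_chain2[OF dH(1) dq[OF s(1)]]])
      have "((\<lambda>s. - (k / s)) has_real_derivative k / s^2) (at s)"
        using s by (auto intro!: derivative_eq_intros simp: power2_eq_square)
      from DERIV_mult[OF DERIV_chain2[OF dH(2) dq[OF s(1)]] this]
      have "((\<lambda>s. H1 (y - q s) * - (k / s)) has_real_derivative
          H2 (y - q s) * - (k / s) * - (k / s) + H1 (y - q s) * (k / s^2)) (at s)"
        by (simp add: algebra_simps)
      then show "((\<lambda>s. ur s y - H1 (y - q s) * - (k / s)) has_real_derivative
          urr s y - (H2 (y - q s) * - (k / s) * - (k / s) + H1 (y - q s) * (k / s^2))) (at s)"
        by (rule DERIV_diff[OF deriv_ur_r[OF s(1)]])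
      show gb: "\<bar>g y s\<bar> \<le> \<delta>" unfolding g_def by (rule close[OF s(3,4)])
      define h where "h = H (y - q s)"
      have hb: "\<bar>h\<bar> < 1" "\<bar>u s y\<bar> < 1" using abs_H_less_1 bounded[OF s(1)] by (auto simp: h_def)
      have eq: "uzz s y - H2 (y - q s) + 0 * (uz s y - H1 (y - q s))
          + (urr s y - (H2 (y - q s) * - (k / s) * - (k / s) + H1 (y - q s) * (k / s^2)))
          + 1 / s * (ur s y - H1 (y - q s) * - (k / s))
        = g y s * ((u s y)^2 + u s y * h + h^2 - 1) + (k / s)^2 * (h - h^3)"
      proof -
        define K i where "K = k / s" and "i = 1 / s"
        have fold: "k / s = K" "k / s^2 = K * i" "1 / s = i"
          by (simp_all add: K_def i_def power2_eq_square)
        have "uzz s y = - urr s y - i * ur s y - u s y + (u s y)^3"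
          using pde[OF s(1), of y] by (simp add: i_def)
        then show ?thesis unfolding fold
          by (simp add: g_def H2_def h_def[symmetric] algebra_simps power2_eq_square power3_eq_cube)
      qed
      have "\<bar>(u s y)^2 + u s y * h + h^2 - 1\<bar> \<le> 2"
      proof -
        have 1: "(u s y)^2 < 1" "h^2 < 1" using hb by (simp_all add: abs_square_less_1)
        have 2: "0 \<le> (u s y + h)^2" "0 \<le> (u s y - h)^2" "0 \<le> (u s y)^2" "0 \<le> h^2" by simp_all
        show ?thesis using 1 2 by (simp add: power2_eq_square algebra_simps)
      qed
      then have "\<bar>g y s * ((u s y)^2 + u s y * h + h^2 - 1)\<bar> \<le> \<delta> * 2"
        unfolding abs_mult using gb \<delta> by (intro mult_mono) auto
      moreover have "\<bar>(k / s)^2 * (h - h^3)\<bar> \<le> \<delta>"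
      proof -
        have "\<bar>h - h^3\<bar> \<le> 1"
        proof -
          have "h - h^3 = h * (1 - h^2)" by (simp add: algebra_simps power2_eq_square power3_eq_cube)
          moreover have "\<bar>1 - h^2\<bar> \<le> 1" using hb abs_square_less_1[of h] by simp
          ultimately show ?thesis using hb mult_mono[of "\<bar>h\<bar>" 1 "\<bar>1 - h^2\<bar>" 1] by (simp add: abs_mult)
        qed
        moreover have "(k / s)^2 \<le> \<delta>"
        proof -
          have "s \<ge> 1 / \<delta>" using ys r by linarith
          then have sd: "1 / s \<le> \<delta>" using \<delta> s by (simp add: field_simps)
          have "(k / s)^2 \<le> (1 / s)^2" using k k_less_1 s by (intro power_mono divide_right_mono) auto
          also have "\<dots> = 1 / s * (1 / s)" by (simp add: power2_eq_square)
          also have "\<dots> \<le> \<delta> * 1" using sd s \<delta> by (intro mult_mono) auto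
          finally show ?thesis by simp
        qed
        ultimately show ?thesis unfolding abs_mult
          using mult_mono[of "\<bar>(k / s)^2\<bar>" \<delta> "\<bar>h - h^3\<bar>" 1] \<delta> by simp
      qed
      ultimately show "\<bar>uzz s y - H2 (y - q s) + 0 * (uz s y - H1 (y - q s))
          + (urr s y - (H2 (y - q s) * - (k / s) * - (k / s) + H1 (y - q s) * (k / s^2)))
          + 1 / s * (ur s y - H1 (y - q s) * - (k / s))\<bar> \<le> 3 * \<delta>"
        unfolding eq by linarith
    next
      show "\<bar>1 / s\<bar> \<le> 1" if "\<bar>s - r\<bar> \<le> 1" for s using pos[OF that] by simp
    qed (use \<delta> in auto)
    then show "\<bar>uz r z - (1 - (H (z - q r))^2) / sqrt 2\<bar> \<le> 112 * \<delta>" by (simp add: H1_def)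
  qed auto
qed

text \<open>\<open>H\<close> satisfies the first-order equation
  \<open>H' = (1 - H^2) / sqrt 2\<close>, and near the interface both \<open>u\<close> and
  \<open>uz\<close> are close to \<open>H\<close> and \<open>H'\<close>. Far from it each of the two
  terms is at most \<open>\<epsilon> / 2\<close> by \<open>profile_bounds\<close>. The divisor 114
  splits as \<open>112 + 2\<close>.\<close>

lemma uz_almost_first_order:
  assumes \<epsilon>: "\<epsilon> > 0"
  obtains R where "R \<ge> 1" "\<And>r z. r \<ge> R \<Longrightarrow> 0 \<le> z \<Longrightarrow> z \<le> r \<Longrightarrow> \<bar>uz r z - (1 - (u r z)^2) / sqrt 2\<bar> \<le> \<epsilon>"
proof -
  obtain C R1 where C: "C > 0" and R1: "R1 \<ge> 5" and qR: "\<And>r. r \<ge> R1 \<Longrightarrow> 0 \<le> q r \<and> q r \<le> r / 32"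
    and bu: "\<And>r z. r \<ge> R1 \<Longrightarrow> 0 \<le> z \<Longrightarrow> z \<le> r \<Longrightarrow> 1 - (u r z)^2 \<le> C / (1 + (z - q r)^2)"
    and br: "\<And>r z. r \<ge> R1 \<Longrightarrow> 0 \<le> z \<Longrightarrow> z \<le> r \<Longrightarrow> \<bar>ur r z\<bar> \<le> C / (1 + (z - q r)^2)"
    and bz: "\<And>r z. r \<ge> R1 \<Longrightarrow> 0 \<le> z \<Longrightarrow> z \<le> r \<Longrightarrow> \<bar>uz r z\<bar> \<le> C / (1 + (z - q r)^2)"
    using profile_bounds by blast
  define \<delta> where "\<delta> = \<epsilon> / 114"
  have \<delta>: "\<delta> > 0" using \<epsilon> by (simp add: \<delta>_def)
  obtain R2 where R2: "\<And>r z. r \<ge> R2 \<Longrightarrow> z \<ge> 2 \<Longrightarrow> \<bar>uz r z - (1 - (H (z - q r))^2) / sqrt 2\<bar> \<le> 112 * \<delta>"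
    using uz_close_to_H_deriv[OF \<delta>] by metis
  obtain R3 where R3: "\<And>r z. r \<ge> R3 \<Longrightarrow> z \<ge> 0 \<Longrightarrow> \<bar>u r z - H (z - q r)\<bar> \<le> \<delta>"
    using asymp_closed[OF \<delta>] by metis
  define A where "A = 2 * C / \<epsilon> + 1"
  have A: "A \<ge> 1" using C \<epsilon> by (simp add: A_def)
  obtain R4 where R4: "\<And>r. r \<ge> R4 \<Longrightarrow> A + 2 \<le> q r"
    using eventually_q[of "A + 2"] by metis
  show thesis
  proof (rule that[of "max (max R1 R2) (max R3 R4)"])
    fix r z assume r': "r \<ge> max (max R1 R2) (max R3 R4)" and z: "0 \<le> z" "z \<le> r"
    then have r: "r \<ge> R1" "r \<ge> R2" "r \<ge> R3" "r \<ge> R4" by auto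
    have r0: "r > 0" using r R1 by simp
    have u1: "\<bar>u r z\<bar> < 1" by (rule bounded[OF r0])
    show "\<bar>uz r z - (1 - (u r z)^2) / sqrt 2\<bar> \<le> \<epsilon>"
    proof (cases "\<bar>z - q r\<bar> \<ge> A")
      case True
      have "A * 1 \<le> \<bar>z - q r\<bar> * \<bar>z - q r\<bar>" using True A by (intro mult_mono) auto
      then have x2: "A \<le> (z - q r)^2" by (simp add: power2_eq_square flip: abs_mult)
      have "C / (1 + (z - q r)^2) \<le> C / (2 * C / \<epsilon>)"
        using x2 C \<epsilon> by (intro divide_left_mono mult_pos_pos) (auto simp: A_def add_pos_nonneg)
      also have "\<dots> = \<epsilon> / 2" using C by simp
      finally have le: "C / (1 + (z - q r)^2) \<le> \<epsilon> / 2" .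
      have "1 - (u r z)^2 \<ge> 0" using u1 abs_square_less_1[of "u r z"] by simp
      moreover have "(1 - (u r z)^2) / sqrt 2 \<le> (1 - (u r z)^2) / 1"
        using calculation by (intro divide_left_mono) auto
      moreover have "(1 - (u r z)^2) / sqrt 2 \<ge> 0" using calculation(1) by (intro divide_nonneg_pos) auto
      ultimately have "\<bar>(1 - (u r z)^2) / sqrt 2\<bar> \<le> \<epsilon> / 2" using bu[OF r(1) z] le unfolding div_by_1 by linarith
      then show ?thesis using bz[OF r(1) z] le by linarith
    next
      case False
      then have z2: "z \<ge> 2" using R4[OF r(4)] by linarith
      define h where "h = H (z - q r)"
      have "\<bar>(u r z)^2 - h^2\<bar> = \<bar>u r z - h\<bar> * \<bar>u r z + h\<bar>"
        by (simp add: power2_eq_square algebra_simps flip: abs_mult)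
      also have "\<dots> \<le> \<delta> * 2"
        using R3[OF r(3) z(1)] u1 abs_H_less_1[of "z - q r"] \<delta> by (intro mult_mono) (auto simp: h_def)
      finally have d: "\<bar>(u r z)^2 - h^2\<bar> \<le> 2 * \<delta>" by simp
      have "\<bar>(1 - h^2) / sqrt 2 - (1 - (u r z)^2) / sqrt 2\<bar> = \<bar>(u r z)^2 - h^2\<bar> / sqrt 2"
        by (simp add: abs_divide flip: diff_divide_distrib)
      also have "\<dots> \<le> \<bar>(u r z)^2 - h^2\<bar> / 1" by (intro divide_left_mono) auto
      finally have "\<bar>(1 - h^2) / sqrt 2 - (1 - (u r z)^2) / sqrt 2\<bar> \<le> 2 * \<delta>" using d by simp
      moreover have "\<bar>uz r z - (1 - h^2) / sqrt 2\<bar> \<le> 112 * \<delta>" unfolding h_def by (rule R2[OF r(2) z2])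
      ultimately show ?thesis unfolding \<delta>_def by linarith
    qed
  qed (use R1 in auto)
qed

end

section \<open>The balance laws\<close>

text \<open>The first inequalities bound \<open>r^2 * T\<close> by a multiple of \<open>F\<close>
  plus a constant, while \<open>CS\<close> bounds \<open>F^2\<close> by the decrease of
  \<open>T\<close>. Together they keep \<open>F\<close> bounded, against its logarithmic growth. The
  \<open>K\<close> term leaves room for the errors of integrals truncated at
  \<open>z = r\<close>.\<close>

lemma flux_energy_incompatible:
  fixes F F' T T' D W K a B R
  assumes R: "R > (0::real)" and B: "B > 0" and a: "a > 0"
    and T: "\<And>r. r \<ge> R \<Longrightarrow> (T has_real_derivative T' r) (at r)"
    and T': "\<And>r. r \<ge> R \<Longrightarrow> T' r \<le> - D r / r"
    and T_nonneg: "\<And>r. r \<ge> R \<Longrightarrow> 0 \<le> T r"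
    and D: "\<And>r. r \<ge> R \<Longrightarrow> D r \<ge> 2 * T r - 8 * W r - 3 * K / r^3"
    and F: "\<And>r. r \<ge> R \<Longrightarrow> (F has_real_derivative F' r) (at r)"
    and F': "\<And>r. r \<ge> R \<Longrightarrow> F' r \<ge> r * W r"
    and W: "\<And>r. r \<ge> R \<Longrightarrow> W r \<ge> a / r^2"
    and CS: "\<And>r. r \<ge> R \<Longrightarrow> F r \<ge> 0 \<Longrightarrow> (F r)^2 \<le> B * r^2 * D r"
    and K: "K \<ge> 0"
  shows False
proof -
  have "r^2 * T r \<le> 8 * F r + 3 * K / R + \<bar>R^2 * T R - 8 * F R\<bar>" if r: "r \<ge> R" for r
  proof -
    \<comment> \<open>The derivative \<open>- 3 * K / s^2\<close> of the last term cancels the error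
      in the lower bound for \<open>D\<close>, multiplied by \<open>s\<close>.\<close>
    define G where "G s = s^2 * T s - 8 * F s + 3 * K / s" for s
    have "G r \<le> G R"
    proof (rule DERIV_nonpos_imp_nonincreasing[OF r])
      fix s assume "R \<le> s" "s \<le> r"
      then have s: "s \<ge> R" "s > 0" using R by auto
      have "(G has_real_derivative 2 * s * T s + s^2 * T' s - 8 * F' s - 3 * K / s^2) (at s)"
        unfolding G_def using s
        by (auto intro!: derivative_eq_intros T F simp: power2_eq_square field_simps)
      moreover have "2 * s * T s + s^2 * T' s - 8 * F' s - 3 * K / s^2 \<le> 0"
      proof -
        have "s^2 * T' s \<le> s^2 * (- D s / s)" using T'[OF s(1)] by (intro mult_left_mono) auto
        also have "\<dots> = - (s * D s)" using s by (simp add: power2_eq_square)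
        also have "\<dots> \<le> - (s * (2 * T s - 8 * W s - 3 * K / s^3))"
          using D[OF s(1)] s by simp
        also have "\<dots> = - 2 * s * T s + 8 * (s * W s) + 3 * K / s^2"
          using s by (simp add: field_simps power2_eq_square power3_eq_cube)
        finally show ?thesis using F'[OF s(1)] by simp
      qed
      ultimately show "\<exists>y. (G has_real_derivative y) (at s) \<and> y \<le> 0" by blast
    qed
    moreover have "3 * K / r \<ge> 0" using K r R by simp
    ultimately show ?thesis by (simp add: G_def)
  qed
  then obtain M where M: "M \<ge> 0" "\<And>r. r \<ge> R \<Longrightarrow> r^2 * T r \<le> 8 * F r + M"
    using K R by (metis (no_types, lifting) abs_ge_zero add.assoc add_nonneg_nonneg divide_nonneg_pos mult_nonneg_nonneg zero_le_numeral)
  have F_mono: "F r \<le> F s" if "R \<le> r" "r \<le> s" for r s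
  proof (rule DERIV_nonneg_imp_nondecreasing[OF that(2)])
    fix x assume "r \<le> x" "x \<le> s"
    then have x: "x \<ge> R" "x > 0" using that R by auto
    have "0 \<le> x * (a / x^2)" using x a by simp
    also have "\<dots> \<le> x * W x" using W[OF x(1)] x by (intro mult_left_mono) auto
    finally show "\<exists>y. (F has_real_derivative y) (at x) \<and> 0 \<le> y"
      using F[OF x(1)] F'[OF x(1)] by force
  qed
  have F_ge: "F R + a * (ln r - ln R) \<le> F r" if r: "r \<ge> R" for r
  proof -
    have "F R - a * ln R \<le> F r - a * ln r"
    proof (rule DERIV_nonneg_imp_nondecreasing[OF r])
      fix x assume "R \<le> x" "x \<le> r"
      then have x: "x \<ge> R" "x > 0" using R by auto
      have "a / x = x * (a / x^2)" using x by (simp add: power2_eq_square)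
      also have "\<dots> \<le> x * W x" using W[OF x(1)] x by (intro mult_left_mono) auto
      finally have "F' x - a / x \<ge> 0" using F'[OF x(1)] by simp
      moreover have "((\<lambda>r. F r - a * ln r) has_real_derivative F' x - a / x) (at x)"
        using x by (auto intro!: derivative_eq_intros F)
      ultimately show "\<exists>y. ((\<lambda>r. F r - a * ln r) has_real_derivative y) (at x) \<and> 0 \<le> y" by blast
    qed
    then show ?thesis by (simp add: algebra_simps)
  qed
  \<comment> \<open>Once \<open>F r \<ge> 1\<close>, the quantity
    \<open>8 * B * (8 * F r + M)\<close> is at most \<open>(L - 1) * F r\<close>; the extra 1 makes
    the final inequality strict. The radius \<open>r\<close> below is large enough for the
    logarithmic growth to give \<open>F r \<ge> L\<close>.\<close>
  define L where "L = 8 * B * (M + 8) + 1"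
  have L: "L \<ge> 1" using B M by (simp add: L_def)
  define r where "r = max R (exp ((L - F R) / a + ln R))"
  have r: "r \<ge> R" "r > 0" using R by (auto simp: r_def)
  have "(L - F R) / a + ln R \<le> ln r"
    using r by (subst ln_ge_iff) (auto simp: r_def)
  then have "L - F R \<le> a * (ln r - ln R)" using a by (simp add: field_simps)
  then have FL: "F r \<ge> L" using F_ge[OF r(1)] by simp
  \<comment> \<open>The mean value theorem stands in for integration over \<open>[r, 2 * r]\<close>:
    at one intermediate \<open>x\<close> the slope of \<open>T\<close> is its average, and
    monotonicity of \<open>F\<close> transfers the estimate back to \<open>r\<close>.\<close>
  obtain x where x: "r < x" "x < 2 * r" "T (2 * r) - T r = (2 * r - r) * T' x"
    using MVT2[of r "2 * r" T T'] T r by auto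
  have xR: "x \<ge> R" "x > 0" using x r by auto
  have "(F r)^2 \<le> (F x)^2" using F_mono[of r x] x r FL L by (intro power_mono) auto
  also have "\<dots> \<le> B * x^2 * D x" using F_mono[of r x] x r FL L xR by (intro CS) auto
  also have "\<dots> = B * x^3 * (D x / x)" using xR by (simp add: power2_eq_square power3_eq_cube)
  also have "\<dots> \<le> B * (2 * r)^3 * (D x / x)"
  proof -
    have "0 \<le> (F x)^2" by simp
    also have "\<dots> \<le> B * x^2 * D x" using F_mono[of r x] x r FL L xR by (intro CS) auto
    finally have "0 \<le> (B * x^2) * D x" .
    moreover have "B * x^2 > 0" using B xR by simp
    ultimately have "D x \<ge> 0" using zero_le_mult_iff[of "B * x^2" "D x"] by linarith
    then have "D x / x \<ge> 0" using xR by simp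
    then show ?thesis using B x xR by (intro mult_right_mono mult_left_mono power_mono) auto
  qed
  also have "\<dots> \<le> B * (2 * r)^3 * (- T' x)"
    using T'[OF xR(1)] B r by (intro mult_left_mono) auto
  also have "\<dots> = 8 * B * (r^2 * (T r - T (2 * r)))"
    using x(3) by (simp add: power2_eq_square power3_eq_cube algebra_simps)
  also have "\<dots> \<le> 8 * B * (8 * F r + M)"
  proof -
    have "r^2 * (T r - T (2 * r)) \<le> r^2 * T r" using T_nonneg[of "2 * r"] r by (simp add: right_diff_distrib)
    also have "\<dots> \<le> 8 * F r + M" by (rule M(2)[OF r(1)])
    finally show ?thesis using B by (intro mult_left_mono) auto
  qed
  also have "\<dots> \<le> 8 * B * (8 * F r + M * F r)"
    using B M FL L mult_left_mono[of 1 "F r" M] by (intro mult_left_mono) auto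
  also have "\<dots> = (L - 1) * F r" by (simp add: L_def algebra_simps)
  also have "\<dots> < L * F r" using FL L by (simp add: algebra_simps)
  also have "\<dots> \<le> F r * F r" using FL L by (intro mult_right_mono) auto
  finally show False by (simp add: power2_eq_square)
qed

lemma integral_inverse_1_plus_square_le:
  fixes r p :: real
  assumes "r \<ge> 0"
  shows "(\<lambda>z. 1 / (1 + (z - p)^2)) integrable_on {0..r}" "integral {0..r} (\<lambda>z. 1 / (1 + (z - p)^2)) \<le> 4"
proof -
  have "((\<lambda>z. 1 / (1 + (z - p)^2)) has_integral arctan (r - p) - arctan (0 - p)) {0..r}"
  proof (rule fundamental_theorem_of_calculus[OF assms])
    fix z :: real
    have "((\<lambda>z. arctan (z - p)) has_real_derivative 1 / (1 + (z - p)^2)) (at z within {0..r})"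
      by (auto intro!: derivative_eq_intros simp: inverse_eq_divide)
    then show "((\<lambda>z. arctan (z - p)) has_vector_derivative 1 / (1 + (z - p)^2)) (at z within {0..r})"
      by (simp add: has_real_derivative_iff_has_vector_derivative)
  qed
  then show "(\<lambda>z. 1 / (1 + (z - p)^2)) integrable_on {0..r}" "integral {0..r} (\<lambda>z. 1 / (1 + (z - p)^2)) \<le> 4"
    using arctan_bounded[of "r - p"] arctan_bounded[of "0 - p"] pi_less_4
    by (auto simp: integral_unique has_integral_integrable)
qed

section \<open>Flux and energy identities\<close>

context two_end_profile
begin

definition W :: "real \<Rightarrow> real" where "W x = (1 - x^2)^2 / 4"

text \<open>
  All integrals stop at \<open>z = r\<close>: decay in \<open>z\<close> is not known for bounded \<open>r\<close>, hence not uniformly in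
  \<open>z\<close>, whereas at \<open>z = r\<close> everything is as small as on the far side of the interface.
\<close>

definition radial_energy :: "real \<Rightarrow> real" where
  "radial_energy r = integral {0..r} (\<lambda>z. (ur r z)^2)"

definition flux :: "real \<Rightarrow> real" where
  "flux r = - integral {0..r} (\<lambda>z. r * ur r z * uz r z)"

definition energy :: "real \<Rightarrow> real" where
  "energy r = integral {0..r} (\<lambda>z. (uz r z)^2 / 2 + W (u r z) - (ur r z)^2 / 2)"

lemma deriv_W: "(f has_real_derivative f') (at x within S) \<Longrightarrow>
    ((\<lambda>x. W (f x)) has_real_derivative ((f x)^3 - f x) * f') (at x within S)"
  unfolding W_def
  by (auto intro!: derivative_eq_intros simp: power2_eq_square power3_eq_cube field_simps)

lemma uz_0: assumes "r > 0" shows "uz r 0 = 0"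
proof -
  have "((\<lambda>z. u r (- z)) has_real_derivative uz r (- 0) * - 1) (at 0)"
    by (rule DERIV_chain2[OF deriv_u_z[OF assms]]) (auto intro!: derivative_eq_intros)
  then have "(u r has_real_derivative - uz r 0) (at 0)" using even[OF assms] by simp
  from DERIV_unique[OF this deriv_u_z[OF assms]] show ?thesis by simp
qed

lemma continuous_on_slices:
  assumes "r > 0"
  shows "continuous_on S (u r)" "continuous_on S (ur r)" "continuous_on S (uz r)"
    "continuous_on S (urr r)" "continuous_on S (urz r)"
proof -
  have *: "continuous_on S (\<lambda>z. f r z)" if "continuous_on ({0<..} \<times> UNIV) (\<lambda>(r, z). f r z)"
    for f :: "real \<Rightarrow> real \<Rightarrow> real"
    by (rule continuous_on_compose2[OF that, where f="\<lambda>z. (r, z)", unfolded case_prod_conv])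
      (use assms in \<open>auto intro!: continuous_intros\<close>)
  show "continuous_on S (u r)" "continuous_on S (ur r)" "continuous_on S (uz r)"
    "continuous_on S (urr r)" "continuous_on S (urz r)"
    using *[OF cont_u] *[OF cont_ur] *[OF cont_uz] *[OF cont_urr] *[OF cont_urz] by simp_all
qed

lemma has_integral_of_deriv:
  fixes \<Phi> \<phi> :: "real \<Rightarrow> real"
  assumes "r > 0" "\<And>z. (\<Phi> has_real_derivative \<phi> z) (at z)"
  shows "(\<phi> has_integral \<Phi> r - \<Phi> 0) {0..r}"
  using assms by (intro fundamental_theorem_of_calculus)
    (auto simp flip: has_real_derivative_iff_has_vector_derivative intro: DERIV_subset)

text \<open>After elimination of \<open>uzz\<close> by the equation, the differentiated integrand is
  the exact \<open>z\<close>-derivative of \<open>\<Phi> = r * (ur^2 / 2 + W u - uz^2 / 2)\<close>.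
  Its value at \<open>z = 0\<close>, where \<open>uz\<close> vanishes, is the main term; the second
  bracket collects the contributions from the moving endpoint \<open>z = r\<close>.\<close>

lemma deriv_flux:
  assumes r: "r > 0"
  shows "(flux has_real_derivative r * ((ur r 0)^2 / 2 + W (u r 0))
    - r * (ur r r * uz r r + (ur r r)^2 / 2 + W (u r r) - (uz r r)^2 / 2)) (at r)"
proof -
  define g where "g s z = s * ur s z * uz s z" for s z
  define g' where "g' s z = ur s z * uz s z + s * urr s z * uz s z + s * ur s z * urz s z" for s z
  have "((\<lambda>r. integral {0..r} (g r)) has_real_derivative integral {0..r} (g' r) + g r r) (at r)"
  proof (rule leibniz_rule_diagonal[OF _ _ _ r])
    show "((\<lambda>s. g s z) has_real_derivative g' s z) (at s)" if "s > 0" for s z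
      unfolding g_def g'_def
      by (rule derivative_eq_intros deriv_ur_r[OF that] deriv_uz_r[OF that] refl | simp add: algebra_simps)+
    show "continuous_on ({0<..} \<times> UNIV) (\<lambda>(r, z). g r z)"
      using cont_ur cont_uz unfolding g_def split_beta by (intro continuous_intros)
    show "continuous_on ({0<..} \<times> UNIV) (\<lambda>(r, z). g' r z)"
      using cont_ur cont_uz cont_urr cont_urz unfolding g'_def split_beta by (intro continuous_intros)
  qed
  moreover define \<Phi> where "\<Phi> z = r * ((ur r z)^2 / 2 + W (u r z) - (uz r z)^2 / 2)" for z
  have "(g' r has_integral \<Phi> r - \<Phi> 0) {0..r}"
  proof (rule has_integral_of_deriv[OF r])
    fix z
    have "(\<Phi> has_real_derivative r * (ur r z * urz r z + ((u r z)^3 - u r z) * uz r z - uz r z * uzz r z)) (at z)"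
      unfolding \<Phi>_def
      by (rule derivative_eq_intros deriv_W deriv_u_z[OF r] deriv_ur_z[OF r] deriv_uz_z[OF r] refl | simp)+
    moreover have eq: "uzz r z = - urr r z - ur r z / r - u r z + (u r z)^3" using pde[OF r, of z] by simp
    moreover have "r * (ur r z * urz r z + ((u r z)^3 - u r z) * uz r z - uz r z * uzz r z) = g' r z"
      unfolding eq using r by (simp add: g'_def field_simps)
    ultimately show "(\<Phi> has_real_derivative g' r z) (at z)" by simp
  qed
  ultimately have "((\<lambda>r. integral {0..r} (g r)) has_real_derivative \<Phi> r - \<Phi> 0 + g r r) (at r)"
    by (simp add: integral_unique)
  moreover have "flux = (\<lambda>r. - integral {0..r} (g r))"
    by (simp add: fun_eq_iff flux_def g_def[abs_def])
  ultimately have "(flux has_real_derivative - (\<Phi> r - \<Phi> 0 + g r r)) (at r)"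
    by (simp only: DERIV_minus)
  then show ?thesis using uz_0[OF r]
    by (simp add: g_def \<Phi>_def algebra_simps)
qed

text \<open>By the equation, the differentiated integrand is the \<open>z\<close>-derivative of
  \<open>uz * ur\<close> plus \<open>ur^2 / r\<close>. The boundary term at \<open>z = 0\<close>
  vanishes with \<open>uz\<close>, and those at \<open>z = r\<close> remain.\<close>

lemma deriv_energy:
  assumes r: "r > 0"
  shows "(energy has_real_derivative radial_energy r / r
    + (uz r r * ur r r + (uz r r)^2 / 2 + W (u r r) - (ur r r)^2 / 2)) (at r)"
proof -
  define g where "g s z = (uz s z)^2 / 2 + W (u s z) - (ur s z)^2 / 2" for s z
  define g' where "g' s z = uz s z * urz s z + ((u s z)^3 - u s z) * ur s z - ur s z * urr s z" for s z
  have "((\<lambda>r. integral {0..r} (g r)) has_real_derivative integral {0..r} (g' r) + g r r) (at r)"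
  proof (rule leibniz_rule_diagonal[OF _ _ _ r])
    show "((\<lambda>s. g s z) has_real_derivative g' s z) (at s)" if "s > 0" for s z
      unfolding g_def g'_def
      by (rule derivative_eq_intros deriv_W deriv_u_r[OF that] deriv_ur_r[OF that] deriv_uz_r[OF that] refl | simp)+
    show "continuous_on ({0<..} \<times> UNIV) (\<lambda>(r, z). g r z)"
      using cont_u cont_ur cont_uz unfolding g_def W_def split_beta by (intro continuous_intros) auto
    show "continuous_on ({0<..} \<times> UNIV) (\<lambda>(r, z). g' r z)"
      using cont_u cont_ur cont_uz cont_urr cont_urz unfolding g'_def split_beta by (intro continuous_intros)
  qed
  moreover have "integral {0..r} (g' r) = uz r r * ur r r + radial_energy r / r"
  proof -
    have "((\<lambda>z. uzz r z * ur r z + uz r z * urz r z) has_integral uz r r * ur r r - uz r 0 * ur r 0) {0..r}"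
    proof (rule has_integral_of_deriv[OF r])
      fix z show "((\<lambda>z. uz r z * ur r z) has_real_derivative uzz r z * ur r z + uz r z * urz r z) (at z)"
        by (rule derivative_eq_intros deriv_ur_z[OF r] deriv_uz_z[OF r] refl | simp)+
    qed
    moreover have "((\<lambda>z. (ur r z)^2) has_integral radial_energy r) {0..r}"
      unfolding radial_energy_def
      by (intro integrable_integral integrable_continuous_real continuous_intros continuous_on_slices[OF r])
    then have "((\<lambda>z. (ur r z)^2 / r) has_integral radial_energy r / r) {0..r}"
      by (rule has_integral_divide)
    ultimately have "((\<lambda>z. uzz r z * ur r z + uz r z * urz r z + (ur r z)^2 / r)
        has_integral uz r r * ur r r - uz r 0 * ur r 0 + radial_energy r / r) {0..r}"
      by (rule has_integral_add)
    moreover have "uzz r z * ur r z + uz r z * urz r z + (ur r z)^2 / r = g' r z" for z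
    proof -
      have eq: "uzz r z = - urr r z - ur r z / r - u r z + (u r z)^3" using pde[OF r, of z] by simp
      show ?thesis unfolding eq by (simp add: g'_def algebra_simps power2_eq_square)
    qed
    ultimately have "(g' r has_integral uz r r * ur r r + radial_energy r / r) {0..r}"
      using uz_0[OF r] by simp
    then show ?thesis by (rule integral_unique)
  qed
  moreover have "energy = (\<lambda>r. integral {0..r} (g r))"
    by (simp add: fun_eq_iff energy_def g_def[abs_def])
  ultimately show ?thesis by (simp add: g_def algebra_simps)
qed


section \<open>Completing the square in the energy\<close>

lemma W_factor: "4 * W x = (1 - x)^2 * (1 + x)^2"
  by (simp add: W_def power2_eq_square field_simps)

text \<open>An antiderivative of \<open>(1 - s^2) / sqrt 2\<close>, which is
  \<open>sqrt (2 * W s)\<close> for \<open>\<bar>s\<bar> \<le> 1\<close>. Its increment from -1 to 1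
  is the energy of the one-dimensional profile.\<close>

definition \<Psi> :: "real \<Rightarrow> real" where "\<Psi> s = (s - s^3 / 3) / sqrt 2"

text \<open>Both differences have a double zero at the phase concerned, as the factorisations
  \<open>e1\<close> and \<open>e2\<close> show. An endpoint that misses its phase therefore costs
  only a quadratic amount, comparable to \<open>W\<close>.\<close>

lemma \<Psi>_upper: "-1 \<le> s \<Longrightarrow> \<Psi> s \<le> \<Psi> 1"
  and \<Psi>_lower: "s \<le> 1 \<Longrightarrow> \<Psi> (-1) \<le> \<Psi> s"
  and \<Psi>_near_1: "s \<le> 1 \<Longrightarrow> \<Psi> 1 - \<Psi> s \<le> (1 - s)^2"
  and \<Psi>_near_minus_1: "-1 \<le> s \<Longrightarrow> \<Psi> s - \<Psi> (-1) \<le> (1 + s)^2"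
proof -
  have e1: "\<Psi> 1 - \<Psi> s = (1 - s)^2 * ((2 + s) / (3 * sqrt 2))"
    by (simp add: \<Psi>_def field_simps power2_eq_square power3_eq_cube)
  have e2: "\<Psi> s - \<Psi> (-1) = (1 + s)^2 * ((2 - s) / (3 * sqrt 2))"
    by (simp add: \<Psi>_def field_simps power2_eq_square power3_eq_cube)
  have s2: "sqrt 2 \<ge> 1" by simp
  show "\<Psi> s \<le> \<Psi> 1" if "-1 \<le> s"
  proof -
    have "\<Psi> 1 - \<Psi> s \<ge> 0" unfolding e1 using that by (intro mult_nonneg_nonneg) auto
    then show ?thesis by simp
  qed
  show "\<Psi> (-1) \<le> \<Psi> s" if "s \<le> 1"
  proof -
    have "\<Psi> s - \<Psi> (-1) \<ge> 0" unfolding e2 using that by (intro mult_nonneg_nonneg) auto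
    then show ?thesis by simp
  qed
  show "\<Psi> 1 - \<Psi> s \<le> (1 - s)^2" if "s \<le> 1"
  proof -
    have "2 + s \<le> 3 * sqrt 2" using that s2 by linarith
    then have "(2 + s) / (3 * sqrt 2) \<le> 1" by (simp add: divide_le_eq)
    from mult_left_mono[OF this zero_le_power2[of "1 - s"]] show ?thesis unfolding e1 by simp
  qed
  show "\<Psi> s - \<Psi> (-1) \<le> (1 + s)^2" if "-1 \<le> s"
  proof -
    have "2 - s \<le> 3 * sqrt 2" using that s2 by linarith
    then have "(2 - s) / (3 * sqrt 2) \<le> 1" by (simp add: divide_le_eq)
    from mult_left_mono[OF this zero_le_power2[of "1 + s"]] show ?thesis unfolding e2 by simp
  qed
qed

text \<open>Pointwise, \<open>uz^2 / 2 + W u\<close> equals \<open>(1 - u^2) / sqrt 2 * uz\<close>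
  plus half the square of \<open>uz - (1 - u^2) / sqrt 2\<close>. The first summand is the
  \<open>z\<close>-derivative of \<open>\<Psi> u\<close>, so only its endpoint values
  remain.\<close>

lemma energy_eq:
  assumes r: "r > 0"
  shows "energy r = \<Psi> (u r r) - \<Psi> (u r 0)
    + integral {0..r} (\<lambda>z. (uz r z - (1 - (u r z)^2) / sqrt 2)^2 / 2) - radial_energy r / 2"
proof -
  have "((\<lambda>z. (1 - (u r z)^2) / sqrt 2 * uz r z) has_integral \<Psi> (u r r) - \<Psi> (u r 0)) {0..r}"
  proof (rule has_integral_of_deriv[OF r])
    fix z
    have "(\<Psi> has_real_derivative (1 - s^2) / sqrt 2) (at s)" for s
      unfolding \<Psi>_def[abs_def]
      by (rule DERIV_cdivide) (auto intro!: derivative_eq_intros simp: power2_eq_square)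
    from DERIV_chain2[OF this deriv_u_z[OF r]]
    show "((\<lambda>z. \<Psi> (u r z)) has_real_derivative (1 - (u r z)^2) / sqrt 2 * uz r z) (at z)" .
  qed
  moreover have "((\<lambda>z. (uz r z - (1 - (u r z)^2) / sqrt 2)^2 / 2) has_integral
      integral {0..r} (\<lambda>z. (uz r z - (1 - (u r z)^2) / sqrt 2)^2 / 2)) {0..r}"
    by (intro integrable_integral integrable_continuous_real continuous_intros continuous_on_slices[OF r]) auto
  moreover have "((\<lambda>z. (ur r z)^2 / 2) has_integral radial_energy r / 2) {0..r}"
    unfolding radial_energy_def
    by (intro has_integral_divide integrable_integral integrable_continuous_real continuous_intros continuous_on_slices[OF r])
  ultimately have "((\<lambda>z. (1 - (u r z)^2) / sqrt 2 * uz r z + (uz r z - (1 - (u r z)^2) / sqrt 2)^2 / 2 - (ur r z)^2 / 2)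
      has_integral \<Psi> (u r r) - \<Psi> (u r 0)
    + integral {0..r} (\<lambda>z. (uz r z - (1 - (u r z)^2) / sqrt 2)^2 / 2) - radial_energy r / 2) {0..r}"
    by (intro has_integral_diff has_integral_add)
  moreover have "(1 - (u r z)^2) / sqrt 2 * uz r z + (uz r z - (1 - (u r z)^2) / sqrt 2)^2 / 2 - (ur r z)^2 / 2
      = (uz r z)^2 / 2 + W (u r z) - (ur r z)^2 / 2" for z
    by (simp add: W_def power2_diff power_divide) (simp add: field_simps)
  ultimately show ?thesis unfolding energy_def by (simp add: integral_unique)
qed

text \<open>Cauchy-Schwarz through the weighted inequality
  \<open>- a * b \<le> l * a^2 / 2 + b^2 / (2 * l)\<close>. The weight
  \<open>l = B * r / flux r\<close> makes the \<open>uz\<close> term contribute at most half of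
  \<open>flux r\<close>, which is absorbed on the left.\<close>

lemma flux_Cauchy_Schwarz:
  assumes r: "r > 0" and B: "integral {0..r} (\<lambda>z. (uz r z)^2) \<le> B" "B > 0" and F: "flux r > 0"
  shows "(flux r)^2 \<le> B * r^2 * radial_energy r"
proof -
  define l where "l = B * r / flux r"
  have l: "l > 0" using r B F by (simp add: l_def)
  define U where "U = integral {0..r} (\<lambda>z. (uz r z)^2)"
  have I: "((\<lambda>z. (ur r z)^2) has_integral radial_energy r) {0..r}" "((\<lambda>z. (uz r z)^2) has_integral U) {0..r}"
    "((\<lambda>z. r * ur r z * uz r z) has_integral - flux r) {0..r}"
    unfolding radial_energy_def U_def flux_def minus_minus
    by (intro integrable_integral integrable_continuous_real continuous_intros continuous_on_slices[OF r])+
  have "flux r \<le> r * (l * radial_energy r / 2 + U / (2 * l))"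
  proof (rule has_integral_le)
    show "((\<lambda>z. - (r * ur r z * uz r z)) has_integral flux r) {0..r}"
      using has_integral_neg[OF I(3)] by simp
    show "((\<lambda>z. r * (l * (ur r z)^2 / 2 + (uz r z)^2 / (2 * l))) has_integral
        r * (l * radial_energy r / 2 + U / (2 * l))) {0..r}"
      by (intro has_integral_mult_right has_integral_add has_integral_divide I)
    fix z
    have "0 \<le> (l * ur r z + uz r z)^2 / (2 * l)" using l by simp
    also have "\<dots> = l * (ur r z)^2 / 2 + (uz r z)^2 / (2 * l) + ur r z * uz r z"
      using l by (simp add: power2_sum power_mult_distrib field_simps power2_eq_square)
    finally have "- (ur r z * uz r z) \<le> l * (ur r z)^2 / 2 + (uz r z)^2 / (2 * l)" by simp
    from mult_left_mono[OF this, of r] r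
    show "- (r * ur r z * uz r z) \<le> r * (l * (ur r z)^2 / 2 + (uz r z)^2 / (2 * l))" by simp
  qed
  also have "\<dots> \<le> r * (l * radial_energy r / 2 + B / (2 * l))"
    using B l r by (intro mult_left_mono add_left_mono divide_right_mono) (auto simp: U_def)
  also have "\<dots> = B * r^2 * radial_energy r / (2 * flux r) + flux r / 2"
    using r B F by (simp add: l_def field_simps power2_eq_square)
  finally have "flux r / 2 \<le> B * r^2 * radial_energy r / (2 * flux r)" by simp
  then show ?thesis using F by (simp add: field_simps power2_eq_square)
qed

text \<open>The corrected defect \<open>T\<close> and flux \<open>F\<close> satisfy all assumptions
  of \<open>flux_energy_incompatible\<close>: their corrections absorb the boundary terms at
  \<open>z = r\<close>, which are of order \<open>r^-4\<close> before the factor \<open>r\<close> in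
  the flux identity.\<close>

lemma no_profile: False
proof -
  obtain C R1 where C: "C > 0" and R1: "R1 \<ge> 5" and qR: "\<And>r. r \<ge> R1 \<Longrightarrow> 0 \<le> q r \<and> q r \<le> r / 32"
    and bu: "\<And>r z. r \<ge> R1 \<Longrightarrow> 0 \<le> z \<Longrightarrow> z \<le> r \<Longrightarrow> 1 - (u r z)^2 \<le> C / (1 + (z - q r)^2)"
    and br: "\<And>r z. r \<ge> R1 \<Longrightarrow> 0 \<le> z \<Longrightarrow> z \<le> r \<Longrightarrow> \<bar>ur r z\<bar> \<le> C / (1 + (z - q r)^2)"
    and bz: "\<And>r z. r \<ge> R1 \<Longrightarrow> 0 \<le> z \<Longrightarrow> z \<le> r \<Longrightarrow> \<bar>uz r z\<bar> \<le> C / (1 + (z - q r)^2)"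
    using profile_bounds by blast
  obtain c0 R2 where c0: "c0 > 0" and R2: "\<And>r. r \<ge> R2 \<Longrightarrow> 1 + u r 0 \<ge> c0 / r"
    using axis_lower_bound by metis
  obtain A R3 where A: "A \<ge> 0"
    and up: "\<And>r z. r \<ge> R3 \<Longrightarrow> q r + A \<le> \<bar>z\<bar> \<Longrightarrow> 1 - u r z \<le> 3 / 10"
    and low: "\<And>r z. r \<ge> R3 \<Longrightarrow> \<bar>z\<bar> \<le> q r - A \<Longrightarrow> 1 + u r z \<le> 3 / 10"
    using near_pure_phases by metis
  obtain R4 where R4: "\<And>r. r \<ge> R4 \<Longrightarrow> A \<le> q r"
    using eventually_q[of A] by metis
  define R where "R = max (max R1 R2) (max R3 R4)"
  have R: "R \<ge> R1" "R \<ge> R2" "R \<ge> R3" "R \<ge> R4" "R > 0" using R1 by (auto simp: R_def)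
  \<comment> \<open>The terms at \<open>z = r\<close> are bounded by \<open>3 * \<beta>^2\<close>
    with \<open>\<beta> = 4 * C / r^2\<close>, and \<open>48 = 3 * 16\<close>.\<close>
  define K where "K = 48 * C^2"
  have K0: "K > 0" using C by (simp add: K_def)
  define \<sigma> where "\<sigma> = \<Psi> 1 - \<Psi> (-1)"
  have sq_nonneg: "0 \<le> 1 - (u r z)^2" if "r > 0" for r z
    using bounded[OF that, of z] abs_square_less_1[of "u r z"] by simp
  have b_le: "C / (1 + (z - q r)^2) \<le> C" for r z
    using C by (simp add: divide_le_eq add_pos_nonneg)
  have int_b: "(\<lambda>z. a / (1 + (z - q r)^2)) integrable_on {0..r} \<and>
      integral {0..r} (\<lambda>z. a / (1 + (z - q r)^2)) \<le> 4 * a" if "r \<ge> 0" "a \<ge> 0" for a r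
  proof -
    have e: "a / (1 + (z - q r)^2) = a * (1 / (1 + (z - q r)^2))" for z by simp
    note I = integral_inverse_1_plus_square_le[OF that(1), of "q r"]
    show ?thesis unfolding e using integrable_on_mult_right[OF I(1), of a] mult_left_mono[OF I(2) that(2)]
      by (simp only: integral_mult_right mult.commute)
  qed

  \<comment> \<open>Since \<open>q r \<le> r / 32\<close>, the point \<open>z = r\<close> is at
    distance at least \<open>r / 2\<close> from the interface, so the bounds of
    \<open>profile_bounds\<close> are at most \<beta> there. The signs of \<open>u r r\<close> and
    \<open>u r 0\<close> come from the closeness to the pure phases.\<close>
  have corner: "\<bar>ur r r * uz r r\<bar> + (ur r r)^2 / 2 + W (u r r) + (uz r r)^2 / 2 \<le> K / r^4"
      "(1 - u r r)^2 \<le> K / r^4" "u r r \<ge> 0" "u r 0 \<le> 0"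
    if r: "r \<ge> R" for r
  proof -
    have r0: "r > 0" "r \<ge> R1" "r \<ge> R3" "r \<ge> R4" using r R by auto
    define \<beta> where "\<beta> = 4 * C / r^2"
    have \<beta>: "\<beta> > 0" using C r0 by (simp add: \<beta>_def)
    have \<beta>2: "\<beta>^2 = 16 * C^2 / r^4" by (simp add: \<beta>_def power_divide power_mult_distrib)
    have "C / (1 + (r - q r)^2) \<le> C / ((r / 2)^2)"
    proof (rule divide_left_mono)
      have "(r / 2)^2 \<le> (r - q r)^2" using qR[OF r0(2)] r0 by (intro power_mono) auto
      then show "(r / 2)^2 \<le> 1 + (r - q r)^2" by simp
    qed (use C r0 in \<open>auto intro!: mult_pos_pos add_pos_nonneg\<close>)
    also have "\<dots> = \<beta>" by (simp add: \<beta>_def power_divide)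
    finally have le: "C / (1 + (r - q r)^2) \<le> \<beta>" .
    have b: "1 - (u r r)^2 \<le> \<beta>" "\<bar>ur r r\<bar> \<le> \<beta>" "\<bar>uz r r\<bar> \<le> \<beta>"
      using bu[OF r0(2), of r] br[OF r0(2), of r] bz[OF r0(2), of r] le r0 by linarith+
    have sq: "(ur r r)^2 \<le> \<beta>^2" "(uz r r)^2 \<le> \<beta>^2" "(1 - (u r r)^2)^2 \<le> \<beta>^2"
      using power_mono[OF b(2), of 2] power_mono[OF b(3), of 2] power_mono[OF b(1) sq_nonneg[OF r0(1)], of 2]
      by simp_all
    have "\<bar>ur r r * uz r r\<bar> \<le> \<beta> * \<beta>" unfolding abs_mult using b \<beta> by (intro mult_mono) auto
    then have pr: "\<bar>ur r r * uz r r\<bar> \<le> \<beta>^2" by (simp add: power2_eq_square)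
    have "K / r^4 = 3 * \<beta>^2" by (simp add: \<beta>2 K_def)
    moreover have "W (u r r) \<le> \<beta>^2 / 4" using sq(3) by (simp add: W_def)
    ultimately show "\<bar>ur r r * uz r r\<bar> + (ur r r)^2 / 2 + W (u r r) + (uz r r)^2 / 2 \<le> K / r^4"
      using sq pr zero_le_power2[of \<beta>] by linarith
    have "q r + A \<le> \<bar>r\<bar>" using R4[OF r0(4)] qR[OF r0(2)] r0 by simp
    from up[OF r0(3) this] show u0: "u r r \<ge> 0" by simp
    have "1 - u r r \<le> (1 - u r r) * (1 + u r r)"
      using u0 bounded[OF r0(1), of r] mult_left_mono[of 1 "1 + u r r" "1 - u r r"] by simp
    also have "\<dots> = 1 - (u r r)^2" by (simp add: algebra_simps power2_eq_square)
    also have "\<dots> \<le> \<beta>" by (rule b(1))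
    finally have "(1 - u r r)^2 \<le> \<beta>^2" using bounded[OF r0(1), of r] by (intro power_mono) auto
    also have "\<dots> \<le> K / r^4" using \<open>K / r^4 = 3 * \<beta>^2\<close> by simp
    finally show "(1 - u r r)^2 \<le> K / r^4" .
    have "\<bar>0\<bar> \<le> q r - A" using R4[OF r0(4)] by simp
    from low[OF r0(3) this] show "u r 0 \<le> 0" by simp
  qed
  have W_nonneg: "W x \<ge> 0" for x by (simp add: W_def)

  have uz_energy: "integral {0..r} (\<lambda>z. (uz r z)^2) \<le> 4 * C^2" if r: "r \<ge> R" for r
  proof -
    have r0: "r > 0" "r \<ge> R1" using r R by auto
    have "integral {0..r} (\<lambda>z. (uz r z)^2) \<le> integral {0..r} (\<lambda>z. C^2 / (1 + (z - q r)^2))"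
    proof (rule integral_le)
      show "(\<lambda>z. (uz r z)^2) integrable_on {0..r}"
        by (intro integrable_continuous_real continuous_intros continuous_on_slices[OF r0(1)])
      show "(\<lambda>z. C^2 / (1 + (z - q r)^2)) integrable_on {0..r}" using int_b[of r "C^2"] r0 by simp
      fix z assume z: "z \<in> {0..r}"
      have "\<bar>uz r z\<bar> * \<bar>uz r z\<bar> \<le> C / (1 + (z - q r)^2) * C"
        using bz[OF r0(2), of z] b_le[of z r] z C by (intro mult_mono) (auto simp: add_pos_nonneg)
      then show "(uz r z)^2 \<le> C^2 / (1 + (z - q r)^2)" by (simp add: power2_eq_square)
    qed
    also have "\<dots> \<le> 4 * C^2" using int_b[of r "C^2"] r0 by simp
    finally show ?thesis .
  qed

  \<comment> \<open>In the square of \<open>energy_eq\<close>, one factor is at most \<delta> by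
    \<open>uz_almost_first_order\<close> and the other is integrable uniformly in \<open>r\<close>.
    Its total contribution is at most \<open>4 * \<delta> * C = \<epsilon>\<close>.\<close>
  have energy_upper: "eventually (\<lambda>r. energy r \<le> \<sigma> + \<epsilon>) at_top" if \<epsilon>: "\<epsilon> > 0" for \<epsilon>
  proof -
    define \<delta> where "\<delta> = \<epsilon> / (4 * C)"
    have \<delta>: "\<delta> > 0" using \<epsilon> C by (simp add: \<delta>_def)
    obtain R5 where R5: "\<And>r z. r \<ge> R5 \<Longrightarrow> 0 \<le> z \<Longrightarrow> z \<le> r \<Longrightarrow> \<bar>uz r z - (1 - (u r z)^2) / sqrt 2\<bar> \<le> \<delta>"
      using uz_almost_first_order[OF \<delta>] by metis
    have "energy r \<le> \<sigma> + \<epsilon>" if "r \<ge> max R R5" for r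
    proof -
      have r: "r \<ge> R" "r \<ge> R1" "r \<ge> R5" "r > 0" using that R by auto
      have "integral {0..r} (\<lambda>z. (uz r z - (1 - (u r z)^2) / sqrt 2)^2 / 2)
          \<le> integral {0..r} (\<lambda>z. (\<delta> * C) / (1 + (z - q r)^2))"
      proof (rule integral_le)
        show "(\<lambda>z. (uz r z - (1 - (u r z)^2) / sqrt 2)^2 / 2) integrable_on {0..r}"
          by (intro integrable_continuous_real continuous_intros continuous_on_slices[OF r(4)]) auto
        show "(\<lambda>z. \<delta> * C / (1 + (z - q r)^2)) integrable_on {0..r}" using int_b[of r "\<delta> * C"] r \<delta> C by simp
        fix z assume z: "z \<in> {0..r}"
        define p where "p = uz r z - (1 - (u r z)^2) / sqrt 2"
        have "(1 - (u r z)^2) / sqrt 2 \<le> (1 - (u r z)^2) / 1"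
          using sq_nonneg[OF r(4), of z] by (intro divide_left_mono) auto
        moreover have "(1 - (u r z)^2) / sqrt 2 \<ge> 0" using sq_nonneg[OF r(4), of z] by simp
        ultimately have "\<bar>p\<bar> \<le> 2 * (C / (1 + (z - q r)^2))"
          using bz[OF r(2), of z] bu[OF r(2), of z] z unfolding p_def div_by_1 by auto
        moreover have "\<bar>p\<bar> \<le> \<delta>" using R5[OF r(3), of z] z by (simp add: p_def)
        ultimately have "\<bar>p\<bar> * \<bar>p\<bar> \<le> \<delta> * (2 * (C / (1 + (z - q r)^2)))" using \<delta> by (intro mult_mono) auto
        also have "\<dots> = 2 * (\<delta> * C / (1 + (z - q r)^2))" by (simp add: ac_simps)
        finally show "(uz r z - (1 - (u r z)^2) / sqrt 2)^2 / 2 \<le> \<delta> * C / (1 + (z - q r)^2)"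
          unfolding p_def[symmetric] power2_eq_square[of p] by linarith
      qed
      also have "\<dots> \<le> 4 * (\<delta> * C)" using int_b[of r "\<delta> * C"] r \<delta> C by simp
      also have "\<dots> = \<epsilon>" using C by (simp add: \<delta>_def)
      finally have "energy r \<le> \<Psi> (u r r) - \<Psi> (u r 0) + \<epsilon> - radial_energy r / 2"
        unfolding energy_eq[OF r(4)] by simp
      moreover have "radial_energy r \<ge> 0" unfolding radial_energy_def by (intro integral_nonneg
          integrable_continuous_real continuous_intros continuous_on_slices[OF r(4)]) auto
      moreover have "\<Psi> (u r r) \<le> \<Psi> 1" "\<Psi> (-1) \<le> \<Psi> (u r 0)"
        using bounded[OF r(4), of r] bounded[OF r(4), of 0] by (auto intro!: \<Psi>_upper \<Psi>_lower)
      ultimately show ?thesis by (simp add: \<sigma>_def)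
    qed
    then show ?thesis unfolding eventually_at_top_linorder by blast
  qed

  \<comment> \<open>The added term has derivative \<open>- K / r^4\<close>, which outweighs the
    boundary terms in \<open>deriv_energy\<close> and makes \<open>T\<close> nonincreasing.\<close>
  define T where "T r = \<sigma> - energy r + K / (3 * r^3)" for r
  define T' where "T' r = - (radial_energy r / r + (uz r r * ur r r + (uz r r)^2 / 2 + W (u r r) - (ur r r)^2 / 2)) - K / r^4" for r
  have T_deriv: "(T has_real_derivative T' r) (at r)" if r: "r \<ge> R" for r
  proof -
    have r0: "r > 0" using r R by simp
    have "((\<lambda>r. K / (3 * r^3)) has_real_derivative - K / r^4) (at r)"
      using r0 by (auto intro!: derivative_eq_intros simp: field_simps eval_nat_numeral)
    from DERIV_add[OF DERIV_diff[OF DERIV_const deriv_energy[OF r0]] this]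
    show ?thesis by (simp add: T_def[abs_def] T'_def)
  qed
  have T'_le: "T' r \<le> - radial_energy r / r" if r: "r \<ge> R" for r
  proof -
    have "uz r r * ur r r = ur r r * uz r r" by simp
    then have "- (uz r r * ur r r + (uz r r)^2 / 2 + W (u r r) - (ur r r)^2 / 2) \<le> K / r^4"
      using corner(1)[OF r] W_nonneg[of "u r r"] zero_le_power2[of "ur r r"] zero_le_power2[of "uz r r"]
      by linarith
    then show ?thesis by (simp add: T'_def)
  qed
  have radial_nonneg: "radial_energy r \<ge> 0" if "r > 0" for r
    unfolding radial_energy_def
    by (intro integral_nonneg integrable_continuous_real continuous_intros continuous_on_slices[OF that]) auto
  \<comment> \<open>\<open>T\<close> is nonincreasing and eventually at least
    \<open>- \<epsilon>\<close> for every positive \<epsilon>.\<close>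
  have T_nonneg: "0 \<le> T r" if r: "r \<ge> R" for r
  proof (rule field_le_epsilon)
    fix \<epsilon> :: real assume "\<epsilon> > 0"
    then obtain s where s: "s \<ge> r" "energy s \<le> \<sigma> + \<epsilon>"
      using eventually_conj[OF energy_upper eventually_ge_at_top[of r]]
      by (metis (mono_tags, lifting) eventually_happens' trivial_limit_at_top_linorder)
    have "T s \<le> T r"
    proof (rule DERIV_nonpos_imp_nonincreasing[OF s(1)])
      fix x assume "r \<le> x" "x \<le> s"
      then have x: "x \<ge> R" "x > 0" using r R by auto
      have "T' x \<le> 0" using T'_le[OF x(1)] divide_nonneg_pos[OF radial_nonneg[OF x(2)] x(2)] by simp
      then show "\<exists>y. (T has_real_derivative y) (at x) \<and> y \<le> 0" using T_deriv[OF x(1)] by blast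
    qed
    moreover have "T s \<ge> - \<epsilon>" using s(2) K0 s(1) r R by (simp add: T_def add_increasing2)
    ultimately show "0 \<le> T r + \<epsilon>" by simp
  qed
  \<comment> \<open>The nonnegative square in \<open>energy_eq\<close> is dropped. What remains of
    the defect is half the radial energy, the deviation of \<open>u r 0\<close> from -1, paid for by
    \<open>4 * W (u r 0)\<close>, and terms of size \<open>K / r^3\<close>.\<close>
  have T_upper: "radial_energy r \<ge> 2 * T r - 8 * W (u r 0) - 3 * K / r^3" if r: "r \<ge> R" for r
  proof -
    have r0: "r > 0" "r \<ge> 5" using r R R1 by auto
    have b: "\<bar>u r 0\<bar> < 1" "\<bar>u r r\<bar> < 1" using bounded[OF r0(1)] by auto
    have "integral {0..r} (\<lambda>z. (uz r z - (1 - (u r z)^2) / sqrt 2)^2 / 2) \<ge> 0"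
      by (intro integral_nonneg integrable_continuous_real continuous_intros continuous_on_slices[OF r0(1)]) auto
    then have "energy r \<ge> \<Psi> (u r r) - \<Psi> (u r 0) - radial_energy r / 2"
      unfolding energy_eq[OF r0(1)] by simp
    moreover have "\<Psi> (u r 0) - \<Psi> (-1) \<le> 4 * W (u r 0)"
    proof -
      have "\<Psi> (u r 0) - \<Psi> (-1) \<le> 1^2 * (1 + u r 0)^2" using b \<Psi>_near_minus_1[of "u r 0"] by simp
      also have "\<dots> \<le> (1 - u r 0)^2 * (1 + u r 0)^2"
        using corner(4)[OF r] by (intro mult_right_mono power_mono) auto
      finally show ?thesis unfolding W_factor .
    qed
    moreover define X where "X = K / r^3"
    have "\<Psi> 1 - \<Psi> (u r r) \<le> X"
    proof -
      have "\<Psi> 1 - \<Psi> (u r r) \<le> (1 - u r r)^2" using b by (intro \<Psi>_near_1) auto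
      also have "\<dots> \<le> K / r^4" by (rule corner(2)[OF r])
      also have "\<dots> \<le> X" unfolding X_def
        using K0 r0 by (intro divide_left_mono power_increasing mult_pos_pos) auto
      finally show ?thesis .
    qed
    moreover have "X \<ge> 0" using K0 r0 by (simp add: X_def)
    moreover have e: "K / (3 * r^3) = X / 3" "3 * K / r^3 = 3 * X" by (simp_all add: X_def)
    ultimately show ?thesis unfolding T_def \<sigma>_def e by argo
  qed
  \<comment> \<open>The correction has derivative \<open>K / r^2\<close>, which covers the boundary
    terms of \<open>deriv_flux\<close>, at most \<open>r * (K / r^4)\<close> for
    \<open>r \<ge> 1\<close>.\<close>
  define F where "F r = flux r - K / r" for r
  show False
  proof (rule flux_energy_incompatible[of R "4 * C^2" "c0^2 / 4" T T' radial_energy "\<lambda>r. W (u r 0)" K F])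
    fix r assume r: "r \<ge> R"
    have r0: "r > 0" "r \<ge> R2" "r \<ge> 1" using r R R1 by auto
    show "(F has_real_derivative r * ((ur r 0)^2 / 2 + W (u r 0))
        - r * (ur r r * uz r r + (ur r r)^2 / 2 + W (u r r) - (uz r r)^2 / 2) + K / r^2) (at r)"
      unfolding F_def
      by (rule derivative_eq_intros deriv_flux[OF r0(1)] refl | use r0 in \<open>simp add: power2_eq_square\<close>)+
    have "ur r r * uz r r + (ur r r)^2 / 2 + W (u r r) - (uz r r)^2 / 2 \<le> K / r^4"
      using corner(1)[OF r] zero_le_power2[of "uz r r"] by linarith
    then have "r * (ur r r * uz r r + (ur r r)^2 / 2 + W (u r r) - (uz r r)^2 / 2) \<le> r * (K / r^4)"
      using r0 by (intro mult_left_mono) auto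
    also have "\<dots> = K / r^3" using r0 by (simp add: eval_nat_numeral)
    also have "\<dots> \<le> K / r^2" using K0 r0 by (intro divide_left_mono power_increasing mult_pos_pos) auto
    finally have "r * (ur r r * uz r r + (ur r r)^2 / 2 + W (u r r) - (uz r r)^2 / 2) \<le> K / r^2" .
    moreover have "r * W (u r 0) \<le> r * ((ur r 0)^2 / 2 + W (u r 0))" using r0 by simp
    ultimately show "r * W (u r 0) \<le> r * ((ur r 0)^2 / 2 + W (u r 0))
        - r * (ur r r * uz r r + (ur r r)^2 / 2 + W (u r r) - (uz r r)^2 / 2) + K / r^2" by linarith
    \<comment> \<open>As \<open>u r 0 \<le> 0\<close>, the factor \<open>(1 - u r 0)^2\<close> is at
      least 1, so \<open>4 * W (u r 0)\<close> is at least \<open>(1 + u r 0)^2\<close>, which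
      \<open>axis_lower_bound\<close> estimates from below.\<close>
    show "c0^2 / 4 / r^2 \<le> W (u r 0)"
    proof -
      have "(c0 / r)^2 \<le> (1 + u r 0)^2" using R2[OF r0(2)] c0 r0 by (intro power_mono) auto
      moreover have "1 * (1 + u r 0)^2 \<le> (1 - u r 0)^2 * (1 + u r 0)^2"
        using power_mono[of 1 "1 - u r 0" 2] corner(4)[OF r] by (intro mult_right_mono) auto
      moreover have "4 * W (u r 0) = (1 - u r 0)^2 * (1 + u r 0)^2"
        by (rule W_factor)
      ultimately show ?thesis by (simp add: power_divide)
    qed
    show "(F r)^2 \<le> 4 * C^2 * r^2 * radial_energy r" if "0 \<le> F r"
    proof -
      have "F r < flux r" using K0 r0 by (simp add: F_def)
      then have "(F r)^2 \<le> (flux r)^2" "flux r > 0" using that by (auto intro!: power_mono)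
      then show ?thesis using flux_Cauchy_Schwarz[OF r0(1) uz_energy[OF r]] C by simp
    qed
  qed (use R C c0 K0 T_deriv T'_le T_nonneg T_upper in auto)
qed

end

theorem theorem2:
  fixes k :: real
  assumes "0 < k" and "k \<le> sqrt 2 / 2"
  shows "\<not> (\<exists>u. two_end_solution k u)"
proof
  assume "\<exists>u. two_end_solution k u"
  then obtain u where "two_end_solution k u" ..
  then obtain c where "two_end_profile u (d_r u) (d_z u) (d_r (d_r u)) (d_z (d_z u)) (d_r (d_z u)) k c"
    using two_end_solution_imp_profile[OF _ assms] by blast
  then show False by (rule two_end_profile.no_profile)
qed

end
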